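(* Let $X$ be the orbit closure of a recurrent, $C$-balanced sequence $w\in\mathcal A^{\mathbb N}$, $\mathcal A=\{1,\dots,d\}$. The map $\pi_{\mathcal J}\circ\phi$ is a generic factor map from $(X,S)$ to the equicontinuous dynamical system $(G,T)$, where $T$ is the torus rotation $$T\colon\mathbb H/\mathcal J\to\mathbb H/\mathcal J,\qquad x\mapsto x+\pi(\mathbf e_1)\ \bmod\ \mathcal J,$$ (restricted to $G$) and $G=\pi_{\mathcal J}(\mathcal R(w))$ is the closed subgroup of $\mathbb H/\mathcal J$ generated by $\pi(\mathbf e_1)$.
   Context: A sequence $w\in\mathcal A^{\mathbb N}$ is $C$-balanced if there is a constant $C\ge1$ such that $\bigl||w_{[j,j+n-1]}|_a-|w_{[k,k+n-1]}|_a\bigr|\le C$ for all $j,k,n\in\mathbb N$ and $a\in\mathcal A$, where $w_{[i,j]}=w_i\cdots w_j$ (empty if $j<i$) and $|u|_a$ is the number of occurrences of $a$ in $u$. It is recurrent if every finite subword of $w$ occurs in $w$ infinitely often. $S$ is the left shift on $\mathcal A^{\mathbb N}$ (product topology), and the orbit closure of $w$ is the closure of $\{S^nw:n\ge0\}$. All elements of $X$ are $C$-balanced and have the same letter frequency vector $\mathbf v=(v_1,\dots,v_d)$, $v_i=\lim_{n\to\infty}\frac1n|w_{[1,n]}|_i$. $\mathbb H\subset\mathbb R^d$ is a fixed $(d-1)$-dimensional linear hyperplane not containing $\mathbf v$, and $\pi$ is the linear projection along $\mathbf v$ onto $\mathbb H$. With $\psi(u)=(|u|_1,\dots,|u|_d)^T$,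 set $\mathcal R(x)=\overline{\{\pi(\psi(x_{[1,n]})):n\ge0\}}$ for $x\in X$ (a compact set). Let $X'$ be the set of points of $X$ with dense shift-orbit in $X$. For $x\in X'$, $\phi(x)$ is the unique vector in $\mathcal R(w)$ with $\mathcal R(x)=\mathcal R(w)-\phi(x)$. $\mathcal J\subset\mathbb H$ is the lattice given by the integer span of $\pi(\mathbf e_i-\mathbf e_1)$, $2\le i\le d$, with $(\mathbf e_i)$ the standard basis of $\mathbb R^d$, and $\pi_{\mathcal J}\colon\mathbb H\to\mathbb H/\mathcal J$ is the natural projection onto the $(d-1)$-dimensional torus. A generic factor map from a transitive system $(X,S)$ to a transitive system $(Y,T)$ is a continuous map $\varphi\colon X'\to Y'$ between the sets of transitive points (points with dense forward orbit) such that $\varphi\circ S=T\circ\varphi$ on $X'$. *)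

theory Defs
  imports "HOL-Analysis.Analysis" "HOL-Algebra.Coset"
begin

text \<open>
  The alphabet \<open>{1,\<dots>,d}\<close> is a finite type \<open>'a\<close> with \<open>d = CARD('a)\<close>, and the coordinates of
  \<open>real^'a\<close> are indexed by the letters. The paper numbers the letters of a sequence from 1; here
  \<open>x :: nat \<Rightarrow> 'a\<close> is numbered from 0, so its prefix of length \<open>n\<close> is \<open>x 0 \<dots> x (n - 1)\<close>.
\<close>

section \<open>Words and sequences\<close>

definition subword :: "(nat \<Rightarrow> 'a) \<Rightarrow> nat \<Rightarrow> nat \<Rightarrow> 'a list" where
  "subword x j n = map x [j..<j + n]"

definition balanced :: "real \<Rightarrow> (nat \<Rightarrow> 'a) \<Rightarrow> bool" where
  "balanced C x \<longleftrightarrow> C \<ge> 1 \<and>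
     (\<forall>j k n a. \<bar>real (count_list (subword x j n) a) - real (count_list (subword x k n) a)\<bar> \<le> C)"

definition recurrent :: "(nat \<Rightarrow> 'a) \<Rightarrow> bool" where
  "recurrent x \<longleftrightarrow> (\<forall>j n. infinite {k. subword x k n = subword x j n})"

definition shift :: "(nat \<Rightarrow> 'a) \<Rightarrow> (nat \<Rightarrow> 'a)" where
  "shift x = (\<lambda>n. x (Suc n))"

definition full_shift :: "(nat \<Rightarrow> 'a) topology" where
  "full_shift = product_topology (\<lambda>_. discrete_topology UNIV) UNIV"

definition orbit_closure :: "(nat \<Rightarrow> 'a) \<Rightarrow> (nat \<Rightarrow> 'a) topology" where
  "orbit_closure w =
     subtopology full_shift (full_shift closure_of {(shift ^^ n) w |n. True})"

definition letter_freq :: "(nat \<Rightarrow> 'a) \<Rightarrow> real ^ 'a::finite" where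
  "letter_freq x = (\<chi> a. lim (\<lambda>n. real (count_list (subword x 0 n) a) / real n))"

section \<open>Topological dynamics\<close>

definition transitive_points :: "'x topology \<Rightarrow> ('x \<Rightarrow> 'x) \<Rightarrow> 'x set" where
  "transitive_points X S =
     {x \<in> topspace X. X closure_of {(S ^^ n) x |n. True} = topspace X}"

definition dynamical_system :: "'x topology \<Rightarrow> ('x \<Rightarrow> 'x) \<Rightarrow> bool" where
  "dynamical_system X S \<longleftrightarrow>
     compact_space X \<and> metrizable_space X \<and> continuous_map X X S"

definition transitive_system :: "'x topology \<Rightarrow> ('x \<Rightarrow> 'x) \<Rightarrow> bool" where
  "transitive_system X S \<longleftrightarrow> dynamical_system X S \<and> transitive_points X S \<noteq> {}"

text \<open>As the space is compact, the choice of the compatible metric is immaterial.\<close>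

definition equicontinuous_system :: "'x topology \<Rightarrow> ('x \<Rightarrow> 'x) \<Rightarrow> bool" where
  "equicontinuous_system X S \<longleftrightarrow> dynamical_system X S \<and>
     (\<exists>\<delta>. Metric_space (topspace X) \<delta> \<and> Metric_space.mtopology (topspace X) \<delta> = X \<and>
        (\<forall>e>0. \<exists>r>0. \<forall>x\<in>topspace X. \<forall>y\<in>topspace X. \<delta> x y < r \<longrightarrow>
           (\<forall>n. \<delta> ((S ^^ n) x) ((S ^^ n) y) < e)))"

text \<open>
  The map \<open>f\<close> is only meaningful on the transitive points of \<open>X\<close>, so the equation
  \<open>f \<circ> S = T \<circ> f\<close> on them presupposes that \<open>S\<close> preserves them; this is spelled out.
\<close>

definition generic_factor_map ::
    "'x topology \<Rightarrow> ('x \<Rightarrow> 'x) \<Rightarrow> 'y topology \<Rightarrow> ('y \<Rightarrow> 'y) \<Rightarrow> ('x \<Rightarrow> 'y) \<Rightarrow> bool" where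
  "generic_factor_map X S Y T f \<longleftrightarrow>
     transitive_system X S \<and> transitive_system Y T \<and>
     continuous_map (subtopology X (transitive_points X S))
       (subtopology Y (transitive_points Y T)) f \<and>
     (\<forall>x\<in>transitive_points X S. S x \<in> transitive_points X S \<and> f (S x) = T (f x))"

section \<open>Quotients and closed subgroups\<close>

definition quotient_topology :: "'x topology \<Rightarrow> ('x \<Rightarrow> 'y) \<Rightarrow> 'y topology" where
  "quotient_topology X q =
     topology (\<lambda>U. U \<subseteq> q ` topspace X \<and> openin X {x \<in> topspace X. q x \<in> U})"

lemma openin_quotient_topology:
  "openin (quotient_topology X q) U \<longleftrightarrow>
     U \<subseteq> q ` topspace X \<and> openin X {x \<in> topspace X. q x \<in> U}"
proof -
  let ?L = "\<lambda>U. U \<subseteq> q ` topspace X \<and> openin X {x \<in> topspace X. q x \<in> U}"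
  have "?L (U \<inter> V)" if "?L U" "?L V" for U V
  proof (intro conjI)
    have "{x \<in> topspace X. q x \<in> U \<inter> V} =
        {x \<in> topspace X. q x \<in> U} \<inter> {x \<in> topspace X. q x \<in> V}" by blast
    moreover have "openin X ({x \<in> topspace X. q x \<in> U} \<inter> {x \<in> topspace X. q x \<in> V})"
      by (rule openin_Int[OF conjunct2[OF that(1)] conjunct2[OF that(2)]])
    ultimately show "openin X {x \<in> topspace X. q x \<in> U \<inter> V}" by (simp only:)
  qed (use that in blast)
  moreover have "?L (\<Union>\<K>)" if "\<forall>K\<in>\<K>. ?L K" for \<K>
  proof (intro conjI)
    have "{x \<in> topspace X. q x \<in> \<Union>\<K>} = \<Union>((\<lambda>K. {x \<in> topspace X. q x \<in> K}) ` \<K>)" by blast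
    moreover have "openin X (\<Union>((\<lambda>K. {x \<in> topspace X. q x \<in> K}) ` \<K>))"
      by (rule openin_Union) (use that in blast)
    ultimately show "openin X {x \<in> topspace X. q x \<in> \<Union>\<K>}" by (simp only:)
  qed (use that in blast)
  ultimately have "istopology ?L"
    unfolding istopology_def by blast
  from topology_inverse'[OF this] show ?thesis
    unfolding quotient_topology_def by (rule fun_cong)
qed

lemma topspace_quotient_topology: "topspace (quotient_topology X q) = q ` topspace X"
proof (rule subset_antisym)
  show "topspace (quotient_topology X q) \<subseteq> q ` topspace X"
    by (rule conjunct1[OF iffD1[OF openin_quotient_topology openin_topspace]])
  have "{x \<in> topspace X. q x \<in> q ` topspace X} = topspace X" by blast
  then have "openin X {x \<in> topspace X. q x \<in> q ` topspace X}" by (simp only: openin_topspace)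
  then have "openin (quotient_topology X q) (q ` topspace X)"
    unfolding openin_quotient_topology by blast
  then show "q ` topspace X \<subseteq> topspace (quotient_topology X q)"
    by (rule openin_subset)
qed

lemma quotient_map_quotient_topology: "quotient_map X (quotient_topology X q) q"
  unfolding quotient_map_def topspace_quotient_topology openin_quotient_topology by blast

definition closed_subgroup_generated :: "('g, 'm) monoid_scheme \<Rightarrow> 'g topology \<Rightarrow> 'g set \<Rightarrow> 'g set"
  where "closed_subgroup_generated \<Gamma> X B =
    \<Inter>{K. subgroup K \<Gamma> \<and> closedin X K \<and> B \<subseteq> K}"

section \<open>The projection along the frequency vector and the torus\<close>

definition proj_along :: "real ^ 'a \<Rightarrow> (real ^ 'a) set \<Rightarrow> real ^ 'a \<Rightarrow> real ^ 'a::finite" where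
  "proj_along v H u = (THE h. h \<in> H \<and> u - h \<in> span {v})"

definition abelianization :: "'a list \<Rightarrow> real ^ 'a::finite" where
  "abelianization u = (\<chi> a. real (count_list u a))"

definition Rauzy_set :: "real ^ 'a \<Rightarrow> (real ^ 'a) set \<Rightarrow> (nat \<Rightarrow> 'a::finite) \<Rightarrow> (real ^ 'a) set" where
  "Rauzy_set v H x = closure {proj_along v H (abelianization (subword x 0 n)) |n. True}"

definition phi ::
    "real ^ 'a \<Rightarrow> (real ^ 'a) set \<Rightarrow> (nat \<Rightarrow> 'a) \<Rightarrow> (nat \<Rightarrow> 'a) \<Rightarrow> real ^ 'a::finite" where
  "phi v H w x =
     (THE t. t \<in> Rauzy_set v H w \<and> Rauzy_set v H x = (\<lambda>y. y - t) ` Rauzy_set v H w)"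

text \<open>
  In the following, \<open>i1\<close> is the letter that plays the role of the letter 1. The \<open>i1\<close>-th summand
  below vanishes.
\<close>

definition J_lattice :: "real ^ 'a \<Rightarrow> (real ^ 'a) set \<Rightarrow> 'a::finite \<Rightarrow> (real ^ 'a) set" where
  "J_lattice v H i1 =
     {\<Sum>i\<in>UNIV. of_int (c i) *\<^sub>R proj_along v H (axis i 1 - axis i1 1) |c :: 'a \<Rightarrow> int. True}"

definition additive_group :: "'v::ab_group_add set \<Rightarrow> 'v monoid" where
  "additive_group V = \<lparr>carrier = V, mult = (+), one = 0\<rparr>"

definition torus :: "real ^ 'a \<Rightarrow> (real ^ 'a) set \<Rightarrow> 'a::finite \<Rightarrow> (real ^ 'a) set monoid" where
  "torus v H i1 = additive_group H Mod J_lattice v H i1"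

definition proj_J :: "real ^ 'a \<Rightarrow> (real ^ 'a) set \<Rightarrow> 'a::finite \<Rightarrow> real ^ 'a \<Rightarrow> (real ^ 'a) set" where
  "proj_J v H i1 x = J_lattice v H i1 #>\<^bsub>additive_group H\<^esub> x"

definition torus_topology ::
    "real ^ 'a \<Rightarrow> (real ^ 'a) set \<Rightarrow> 'a::finite \<Rightarrow> (real ^ 'a) set topology" where
  "torus_topology v H i1 = quotient_topology (top_of_set H) (proj_J v H i1)"

definition torus_rotation ::
    "real ^ 'a \<Rightarrow> (real ^ 'a) set \<Rightarrow> 'a::finite \<Rightarrow> (real ^ 'a) set \<Rightarrow> (real ^ 'a) set" where
  "torus_rotation v H i1 c =
     c \<otimes>\<^bsub>torus v H i1\<^esub> proj_J v H i1 (proj_along v H (axis i1 1))"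

end

theory Submission
  imports Defs
begin

text \<open>
  The steps of the walk \<open>n \<mapsto> \<pi>(\<psi>(x\<^sub>0\<dots>x\<^bsub>n-1\<^esub>))\<close> differ from letter to letter, but they all agree modulo
  \<open>J\<close>: seen on the torus, the walk of every sequence is the orbit of 0 under the rotation by
  \<open>\<alpha> = \<pi>(e\<^sub>1)\<close>. Balance makes the walk of \<open>w\<close> bounded, so that \<open>R(w)\<close> is compact and its image \<open>G\<close> is the
  closure of that orbit.

  The map \<open>\<phi>\<close>. If the shifts \<open>S\<^bsup>n(k)\<^esup>w\<close> converge to \<open>x\<close> and the positions of the walk of \<open>w\<close> at the times
  \<open>n(k)\<close> converge to \<open>t\<close>, then \<open>R(x) + t \<subseteq> R(w)\<close>. If \<open>x\<close> is transitive, the same argument with the roles of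
  \<open>x\<close> and \<open>w\<close> exchanged gives \<open>R(w) + s \<subseteq> R(x)\<close>; as a bounded set is not mapped into itself by a nonzero
  translation, \<open>s = -t\<close> and \<open>R(x) = R(w) - t\<close>, which means \<open>\<phi>(x) = t\<close> (\<open>Rauzy_translate\<close>). So \<open>\<phi>(x)\<close> is the
  only possible limit of the walk of \<open>w\<close> along times at which the shifts of \<open>w\<close> approach \<open>x\<close>. By compactness
  this characterisation yields continuity (\<open>prefix_sum_near_phi\<close>, \<open>continuous_map_phi\<close>), and moving all
  times by one gives \<open>\<phi>(Sx) = \<phi>(x) + \<pi>(e\<^bsub>x(0)\<^esub>)\<close> (\<open>phi_shift\<close>), which modulo \<open>J\<close> is the rotation.

  The group \<open>G\<close>. Its preimage in \<open>H\<close> is the closure of \<open>{n\<alpha> + j | n \<ge> 0, j \<in> J}\<close> (\<open>proj_J_in_G_iff\<close>), the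
  closure of an additive monoid. By recurrence \<open>w\<close> returns close to itself at positive times \<open>n + 1\<close>, at
  which the walk is close to \<open>\<phi>(w) = 0\<close>; one step earlier the rotation is close to \<open>-\<alpha>\<close>. Hence the closure
  contains \<open>-\<alpha>\<close> and is a group (\<open>minus_rotation_in_closure\<close>), so \<open>G\<close> is the closed subgroup generated by
  \<open>\<alpha>\<close> and every orbit in \<open>G\<close> is dense. The rotation is an isometry of the quotient metric, which exists
  because \<open>J\<close> is closed; this is equicontinuity.
\<close>

section \<open>Translations and closures of additive monoids\<close>

text \<open>
  This rigidity determines \<open>\<phi>\<close>: it gives the uniqueness of the translation vector, and it turns two
  inclusions between translates into an equality.
\<close>

lemma bounded_translation_eq_0:
  fixes A :: "'b::real_normed_vector set"
  assumes "bounded A" "A \<noteq> {}" "\<And>u. u \<in> A \<Longrightarrow> u + t \<in> A"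
  shows "t = 0"
proof (rule ccontr)
  assume "t \<noteq> 0"
  obtain B where B: "\<And>u. u \<in> A \<Longrightarrow> norm u \<le> B"
    using \<open>bounded A\<close> by (auto simp: bounded_iff)
  obtain a where "a \<in> A" using \<open>A \<noteq> {}\<close> by blast
  have iterate: "a + real n *\<^sub>R t \<in> A" for n
  proof (induction n)
    case (Suc n)
    then have "(a + real n *\<^sub>R t) + t \<in> A" by (rule assms)
    then show ?case by (simp add: algebra_simps)
  qed (use \<open>a \<in> A\<close> in simp)
  obtain n where n: "2 * B < real n * norm t"
    using reals_Archimedean3 \<open>t \<noteq> 0\<close> by (metis zero_less_norm_iff)
  have "real n * norm t = norm ((a + real n *\<^sub>R t) - a)" by simp
  also have "\<dots> \<le> norm (a + real n *\<^sub>R t) + norm a" by (rule norm_triangle_ineq4)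
  also have "\<dots> \<le> 2 * B" using B[OF iterate[of n]] B[OF \<open>a \<in> A\<close>] by linarith
  finally show False using n by simp
qed

lemma closure_add_closed:
  fixes M :: "'b::real_normed_vector set"
  assumes "\<And>x y. x \<in> M \<Longrightarrow> y \<in> M \<Longrightarrow> x + y \<in> M"
    and "x \<in> closure M" "y \<in> closure M"
  shows "x + y \<in> closure M"
proof -
  obtain f g where "\<And>n. f n \<in> M" "f \<longlonglongrightarrow> x" "\<And>n. g n \<in> M" "g \<longlonglongrightarrow> y"
    using assms(2,3) unfolding closure_sequential by blast
  then show ?thesis
    unfolding closure_sequential
    by (intro exI[of _ "\<lambda>n. f n + g n"]) (auto intro: assms tendsto_add)
qed

lemma closure_minus_closed:
  fixes M :: "'b::real_normed_vector set"
  assumes "\<And>x. x \<in> M \<Longrightarrow> - x \<in> closure M" and "x \<in> closure M"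
  shows "- x \<in> closure M"
proof -
  obtain f where "\<And>n. f n \<in> M" "f \<longlonglongrightarrow> x"
    using assms(2) unfolding closure_sequential by blast
  then have "\<And>n. - f n \<in> closure M" "(\<lambda>n. - f n) \<longlonglongrightarrow> - x"
    by (auto intro: assms tendsto_minus)
  then show ?thesis using closed_sequentially[OF closed_closure, of "\<lambda>n. - f n"] by blast
qed

section \<open>Quasi-additive sequences\<close>

lemma quasi_additive_mult:
  fixes f :: "nat \<Rightarrow> real"
  assumes "\<And>m n. \<bar>f (m + n) - f m - f n\<bar> \<le> C"
  shows "\<bar>f (Suc k * n) - real (Suc k) * f n\<bar> \<le> real k * C"
proof (induction k)
  case (Suc k)
  have "f (Suc (Suc k) * n) - real (Suc (Suc k)) * f n
      = (f (n + Suc k * n) - f n - f (Suc k * n)) + (f (Suc k * n) - real (Suc k) * f n)"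
    by (simp add: algebra_simps)
  also have "\<bar>\<dots>\<bar> \<le> C + real k * C"
    using assms[of n "Suc k * n"] Suc.IH by linarith
  finally show ?case by (simp add: distrib_right)
qed simp

text \<open>
  Expanding \<open>f (n * k)\<close> into \<open>k\<close> copies of \<open>f n\<close> and into \<open>n\<close> copies of \<open>f k\<close> costs fewer than \<open>n + k\<close>
  defects in total, so \<open>f n / n\<close> and \<open>f k / k\<close> differ by at most \<open>C / n + C / k\<close>. This makes the
  quotients a Cauchy sequence, and \<open>k \<rightarrow> \<infinity>\<close> gives the bound on the deviation from the limit.
\<close>

lemma quasi_additive_limit:
  fixes f :: "nat \<Rightarrow> real"
  assumes qa: "\<And>m n. \<bar>f (m + n) - f m - f n\<bar> \<le> C"
  defines "L \<equiv> lim (\<lambda>n. f n / real n)"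
  shows "(\<lambda>n. f n / real n) \<longlonglongrightarrow> L" and "\<bar>f n - real n * L\<bar> \<le> C"
proof -
  have C: "0 \<le> C" using qa[of 0 0] by linarith
  have mult: "\<bar>f (k * n) - real k * f n\<bar> \<le> real k * C" if "k \<ge> 1" for k n
  proof -
    obtain j where "k = Suc j" using \<open>k \<ge> 1\<close> by (cases k) auto
    have "\<bar>f (Suc j * n) - real (Suc j) * f n\<bar> \<le> real j * C"
      by (rule quasi_additive_mult[where f = f, OF qa])
    also have "\<dots> \<le> real k * C"
      using C \<open>k = Suc j\<close> by (intro mult_right_mono) auto
    finally show ?thesis by (simp only: \<open>k = Suc j\<close>)
  qed
  have cross: "\<bar>f n / real n - f k / real k\<bar> \<le> C / real n + C / real k" if "n \<ge> 1" "k \<ge> 1" for n k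
  proof -
    have "\<bar>real k * f n - real n * f k\<bar> \<le> (real k + real n) * C"
      using mult[OF that(2), of n] mult[OF that(1), of k]
      by (simp add: algebra_simps)
    then have "\<bar>real k * f n - real n * f k\<bar> / (real n * real k) \<le> (real k + real n) * C / (real n * real k)"
      by (intro divide_right_mono) auto
    moreover have "\<bar>real k * f n - real n * f k\<bar> / (real n * real k) = \<bar>f n / real n - f k / real k\<bar>"
    proof -
      have "f n / real n - f k / real k = (real k * f n - real n * f k) / (real n * real k)"
        using that by (simp add: field_simps)
      then show ?thesis by (simp add: abs_divide)
    qed
    moreover have "(real k + real n) * C / (real n * real k) = C / real n + C / real k"
      using that by (simp add: field_simps)
    ultimately show ?thesis by simp
  qed
  have "Cauchy (\<lambda>n. f n / real n)"
  proof (rule metric_CauchyI)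
    fix e :: real assume "e > 0"
    obtain N :: nat where "2 * C / e < real N" using reals_Archimedean2 by blast
    define M where "M = Suc N"
    have M: "M \<ge> 1" "C / real M < e / 2"
      using \<open>2 * C / e < real N\<close> \<open>e > 0\<close> by (auto simp: M_def field_simps)
    have "dist (f n / real n) (f k / real k) < e" if "n \<ge> M" "k \<ge> M" for n k
    proof -
      have "C / real n \<le> C / real M" "C / real k \<le> C / real M"
        using that M C by (auto intro!: divide_left_mono)
      moreover have "n \<ge> 1" "k \<ge> 1" using that M by auto
      ultimately show ?thesis using cross[of n k] M(2) unfolding dist_real_def by linarith
    qed
    then show "\<exists>M. \<forall>m\<ge>M. \<forall>n\<ge>M. dist (f m / real m) (f n / real n) < e" by blast
  qed
  then show lim: "(\<lambda>n. f n / real n) \<longlonglongrightarrow> L"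
    unfolding L_def by (simp add: Cauchy_convergent_iff convergent_LIMSEQ_iff)
  show "\<bar>f n - real n * L\<bar> \<le> C"
  proof (cases "n = 0")
    case True
    then show ?thesis using qa[of 0 0] by simp
  next
    case False
    have "(\<lambda>k. \<bar>f n / real n - f k / real k\<bar>) \<longlonglongrightarrow> \<bar>f n / real n - L\<bar>"
      by (intro tendsto_intros lim)
    moreover have "(\<lambda>k. C / real n + C / real k) \<longlonglongrightarrow> C / real n + 0"
      by (intro tendsto_intros lim_const_over_n)
    ultimately have "\<bar>f n / real n - L\<bar> \<le> C / real n + 0"
      by (rule LIMSEQ_le) (use cross[of n] False in \<open>auto intro!: exI[of _ 1]\<close>)
    moreover have "f n - real n * L = real n * (f n / real n - L)"
      using False by (simp add: field_simps)
    ultimately show ?thesis using False by (simp add: abs_mult field_simps)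
  qed
qed

section \<open>The projection onto a hyperplane\<close>

locale transversal_hyperplane =
  fixes v :: "real ^ 'a::finite" and H :: "(real ^ 'a) set"
  assumes subspace_H: "subspace H" and dim_H: "dim H = CARD('a) - 1" and v_notin: "v \<notin> H"
begin

abbreviation P :: "real ^ 'a \<Rightarrow> real ^ 'a" where "P \<equiv> proj_along v H"

lemma scale_v_in_H_iff: "k *\<^sub>R v \<in> H \<longleftrightarrow> k = 0"
proof
  assume "k *\<^sub>R v \<in> H"
  then have "inverse k *\<^sub>R k *\<^sub>R v \<in> H" by (rule subspace_scale[OF subspace_H])
  then show "k = 0" using v_notin by (cases "k = 0") auto
qed (simp add: subspace_0[OF subspace_H])

lemma decomposition: "\<exists>k. u - k *\<^sub>R v \<in> H"
proof -
  have "v \<notin> span H" using v_notin subspace_H by (metis span_eq_iff)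
  moreover have "CARD('a) \<ge> 1" by (simp add: Suc_leI)
  ultimately have "dim (insert v H) = DIM(real ^ 'a)"
    using dim_H by (simp add: dim_insert)
  then have "span (insert v H) = UNIV" by (simp only: dim_eq_full)
  then have "u \<in> span (insert v H)" by simp
  then show ?thesis
    using subspace_H unfolding span_breakdown_eq by (metis span_eq_iff)
qed

lemma proj_eqI:
  assumes "h \<in> H" "u - h = k *\<^sub>R v" shows "P u = h"
  unfolding proj_along_def
proof (rule the_equality)
  show "h \<in> H \<and> u - h \<in> span {v}" using assms by (auto simp: span_singleton)
next
  fix h' assume h': "h' \<in> H \<and> u - h' \<in> span {v}"
  then obtain l where "u - h' = l *\<^sub>R v" by (auto simp: span_singleton)
  then have "h - h' = (l - k) *\<^sub>R v" using assms(2) by (simp add: algebra_simps)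
  moreover have "h - h' \<in> H" using h' assms(1) by (simp add: subspace_diff[OF subspace_H])
  ultimately show "h' = h" using scale_v_in_H_iff by auto
qed

lemma proj_in: "P u \<in> H"
  using decomposition[of u] proj_eqI[where u = u] by force

lemma proj_diff: "\<exists>k. u - P u = k *\<^sub>R v"
proof -
  obtain k where "u - k *\<^sub>R v \<in> H" using decomposition by blast
  then have "P u = u - k *\<^sub>R v" by (rule proj_eqI[where k = k]) simp
  then show ?thesis by simp
qed

lemma linear_proj: "linear P"
proof (rule linearI)
  fix x y :: "real ^ 'a" and r :: real
  obtain k l where kl: "x - P x = k *\<^sub>R v" "y - P y = l *\<^sub>R v" using proj_diff by blast
  have "x + y - (P x + P y) = (k + l) *\<^sub>R v"
    using kl by (simp add: algebra_simps)
  then show "P (x + y) = P x + P y"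
    by (rule proj_eqI[rotated]) (intro subspace_add[OF subspace_H] proj_in)
  have "r *\<^sub>R x - r *\<^sub>R P x = (r * k) *\<^sub>R v"
    using kl(1) by (metis scaleR_diff_right scaleR_scaleR)
  then show "P (r *\<^sub>R x) = r *\<^sub>R P x"
    by (rule proj_eqI[rotated]) (intro subspace_scale[OF subspace_H] proj_in)
qed

lemma proj_v: "P v = 0"
  by (rule proj_eqI[where k = 1]) (auto intro: subspace_0[OF subspace_H])

lemma closed_H: "closed H"
  by (rule closed_subspace[OF subspace_H])

end

section \<open>The lattice and the torus\<close>

locale frequency_hyperplane = transversal_hyperplane v H
  for v :: "real ^ 'a::finite" and H +
  fixes i1 :: 'a
  assumes sum_v: "(\<Sum>a\<in>UNIV. v $ a) = 1"
begin

abbreviation J :: "(real ^ 'a) set" where "J \<equiv> J_lattice v H i1"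
abbreviation \<pi>\<^sub>J :: "real ^ 'a \<Rightarrow> (real ^ 'a) set" where "\<pi>\<^sub>J \<equiv> proj_J v H i1"
abbreviation \<alpha> :: "real ^ 'a" where "\<alpha> \<equiv> P (axis i1 1)"

text \<open>
  The linear map \<open>h \<mapsto> h - (\<Sum>b. h $ b) *\<^sub>R v\<close> inverts the projection on the vectors with coordinate
  sum 0, because the coordinates of \<open>v\<close> sum to 1. It therefore carries \<open>J\<close> back to the integer
  vectors with coordinate sum 0, and so \<open>J\<close> is the preimage in \<open>H\<close> of the closed set of integer vectors.
\<close>

lemma J_iff: "h \<in> J \<longleftrightarrow> h \<in> H \<and> (\<forall>a. h $ a - (\<Sum>b\<in>UNIV. h $ b) * v $ a \<in> \<int>)"
proof
  assume "h \<in> J"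
  then obtain c :: "'a \<Rightarrow> int" where "h = (\<Sum>i\<in>UNIV. of_int (c i) *\<^sub>R P (axis i 1 - axis i1 1))"
    unfolding J_lattice_def by blast
  also have "\<dots> = P (\<Sum>i\<in>UNIV. of_int (c i) *\<^sub>R (axis i 1 - axis i1 1))"
    by (simp add: linear_sum[OF linear_proj] linear_scale[OF linear_proj])
  finally have h: "h = P (\<Sum>i\<in>UNIV. of_int (c i) *\<^sub>R (axis i 1 - axis i1 1))" (is "h = P ?z") .
  obtain k where k: "?z - h = k *\<^sub>R v" using proj_diff[of ?z] h by auto
  have z: "?z $ a = (\<Sum>i\<in>UNIV. of_int (c i) * (axis i 1 $ a - axis i1 1 $ a))" for a
    by simp
  have int: "?z $ a \<in> \<int>" for a
    unfolding z by (intro Ints_sum Ints_mult Ints_diff) (auto simp: axis_def)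
  have "(\<Sum>a\<in>UNIV. ?z $ a) = (\<Sum>i\<in>UNIV. \<Sum>a\<in>UNIV. of_int (c i) * (axis i 1 $ a - axis i1 1 $ a))"
    unfolding z by (rule sum.swap)
  also have "\<dots> = 0"
    by (simp add: axis_def sum_subtractf flip: sum_distrib_left)
  finally have sum0: "(\<Sum>a\<in>UNIV. ?z $ a) = 0" .
  have ha: "h $ a = ?z $ a - k * v $ a" for a
    using arg_cong[OF k, of "\<lambda>u. u $ a"] by (simp del: sum_component)
  have "(\<Sum>b\<in>UNIV. h $ b) = (\<Sum>b\<in>UNIV. ?z $ b) - k * (\<Sum>b\<in>UNIV. v $ b)"
    unfolding ha by (simp add: sum_subtractf sum_distrib_left del: sum_component)
  then have "(\<Sum>b\<in>UNIV. h $ b) = - k" using sum0 sum_v by (simp del: sum_component)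
  then have preimage: "h $ a - (\<Sum>b\<in>UNIV. h $ b) * v $ a = ?z $ a" for a
    using ha[of a] by (simp del: sum_component)
  have "h \<in> H" unfolding h by (rule proj_in)
  then show "h \<in> H \<and> (\<forall>a. h $ a - (\<Sum>b\<in>UNIV. h $ b) * v $ a \<in> \<int>)"
    unfolding preimage using int by blast
next
  assume r: "h \<in> H \<and> (\<forall>a. h $ a - (\<Sum>b\<in>UNIV. h $ b) * v $ a \<in> \<int>)"
  define s where "s = (\<Sum>b\<in>UNIV. h $ b)"
  have "\<forall>a. \<exists>c::int. h $ a - s * v $ a = of_int c"
    using r unfolding s_def Ints_def by blast
  then obtain c :: "'a \<Rightarrow> int" where c: "\<And>a. h $ a - s * v $ a = of_int (c a)" by metis
  have c0: "(\<Sum>a\<in>UNIV. real_of_int (c a)) = 0"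
    unfolding c[symmetric] using sum_v by (simp add: sum_subtractf s_def flip: sum_distrib_left)
  have "(\<Sum>i\<in>UNIV. real_of_int (c i) *\<^sub>R (axis i 1 - axis i1 1))
      = (\<Sum>i\<in>UNIV. real_of_int (c i) *\<^sub>R axis i 1) - (\<Sum>i\<in>UNIV. real_of_int (c i)) *\<^sub>R axis i1 (1::real)"
    by (simp add: scaleR_diff_right sum_subtractf scaleR_left.sum)
  also have "\<dots> = h - s *\<^sub>R v"
    unfolding c0 by (simp add: vec_eq_iff c axis_def if_distrib cong: if_cong)
  finally have "(\<Sum>i\<in>UNIV. real_of_int (c i) *\<^sub>R (axis i 1 - axis i1 1)) - h = (- s) *\<^sub>R v"
    by simp
  then have "P (\<Sum>i\<in>UNIV. real_of_int (c i) *\<^sub>R (axis i 1 - axis i1 1)) = h"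
    using r by (intro proj_eqI[where k = "- s"]) auto
  then have "h = (\<Sum>i\<in>UNIV. of_int (c i) *\<^sub>R P (axis i 1 - axis i1 1))"
    by (simp add: linear_sum[OF linear_proj] linear_scale[OF linear_proj])
  then show "h \<in> J" unfolding J_lattice_def by blast
qed

lemma J_sub_H: "J \<subseteq> H"
  using J_iff by blast

lemma J_0: "0 \<in> J"
  by (simp add: J_iff subspace_0[OF subspace_H])

lemma J_diff: "x - y \<in> J" if "x \<in> J" "y \<in> J"
proof -
  have "(x - y) $ a - (\<Sum>b\<in>UNIV. (x - y) $ b) * v $ a
      = (x $ a - (\<Sum>b\<in>UNIV. x $ b) * v $ a) - (y $ a - (\<Sum>b\<in>UNIV. y $ b) * v $ a)" for a
    by (simp add: sum_subtractf algebra_simps)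
  then show ?thesis
    using that unfolding J_iff by (metis Ints_diff subspace_diff[OF subspace_H])
qed

lemma J_minus: "- x \<in> J" if "x \<in> J"
  using J_diff[OF J_0 that] by simp

lemma J_add: "x + y \<in> J" if "x \<in> J" "y \<in> J"
  using J_diff[OF that(1) J_minus[OF that(2)]] by simp

lemma closed_J: "closed J"
proof -
  have "J = H \<inter> (\<Inter>a. (\<lambda>h. h $ a - (\<Sum>b\<in>UNIV. h $ b) * v $ a) -` \<int>)"
    by (auto simp: J_iff)
  moreover have "closed ((\<lambda>h. h $ a - (\<Sum>b\<in>UNIV. h $ b) * v $ a) -` \<int>)" for a
    by (intro closed_vimage closed_Ints continuous_intros)
  ultimately show ?thesis using closed_H by (simp add: closed_INT closed_Int)
qed

lemma proj_axis_diff_in_J: "P (axis a 1) - \<alpha> \<in> J"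
proof -
  have "P (axis a 1) - \<alpha> = P (axis a 1 - axis i1 1)" by (simp add: linear_diff[OF linear_proj])
  also have "\<dots> = (\<Sum>i\<in>UNIV. of_int (if i = a then 1 else 0) *\<^sub>R P (axis i 1 - axis i1 1))"
  proof -
    have "(\<Sum>i\<in>UNIV. of_int (if i = a then 1 else 0) *\<^sub>R P (axis i 1 - axis i1 1))
        = (\<Sum>i\<in>UNIV. if i = a then P (axis i 1 - axis i1 1) else 0)"
      by (intro sum.cong) auto
    then show ?thesis by simp
  qed
  finally show ?thesis
    unfolding J_lattice_def mem_Collect_eq by (intro exI[of _ "\<lambda>i. if i = a then 1 else 0"]) simp
qed

lemma proj_J_eq: "\<pi>\<^sub>J x = (\<lambda>j. j + x) ` J"
  by (auto simp: proj_J_def r_coset_def additive_group_def)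

lemma mem_proj_J: "y \<in> \<pi>\<^sub>J x \<longleftrightarrow> y - x \<in> J"
  unfolding proj_J_eq by (force intro: image_eqI[of _ _ "y - x"])

lemma proj_J_eq_iff: "\<pi>\<^sub>J x = \<pi>\<^sub>J y \<longleftrightarrow> x - y \<in> J"
proof
  assume "\<pi>\<^sub>J x = \<pi>\<^sub>J y"
  then show "x - y \<in> J" by (metis mem_proj_J J_0 diff_self)
next
  assume d: "x - y \<in> J"
  have "z - x \<in> J \<longleftrightarrow> z - y \<in> J" for z
    using J_add[OF _ d, of "z - x"] J_diff[OF _ d, of "z - y"] by auto
  then show "\<pi>\<^sub>J x = \<pi>\<^sub>J y" by (auto simp: mem_proj_J)
qed

lemma comm_group_H: "comm_group (additive_group H)"
proof (rule comm_groupI)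
  fix x assume "x \<in> carrier (additive_group H)"
  then show "\<exists>y\<in>carrier (additive_group H). y \<otimes>\<^bsub>additive_group H\<^esub> x = \<one>\<^bsub>additive_group H\<^esub>"
    by (auto simp: additive_group_def intro!: bexI[of _ "- x"] subspace_neg[OF subspace_H])
qed (auto simp: additive_group_def algebra_simps subspace_add[OF subspace_H] subspace_0[OF subspace_H])

lemma subgroup_J: "subgroup J (additive_group H)"
proof -
  interpret comm_group "additive_group H" by (rule comm_group_H)
  show ?thesis
  proof (rule subgroupI)
    show "J \<subseteq> carrier (additive_group H)" using J_sub_H by (simp add: additive_group_def)
    show "J \<noteq> {}" using J_0 by blast
  next
    fix x assume "x \<in> J"
    then have "inv\<^bsub>additive_group H\<^esub> x = - x"
      using J_sub_H J_minus by (intro inv_equality) (auto simp: additive_group_def)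
    then show "inv\<^bsub>additive_group H\<^esub> x \<in> J" using J_minus[OF \<open>x \<in> J\<close>] by simp
  next
    fix x y assume "x \<in> J" "y \<in> J"
    then show "x \<otimes>\<^bsub>additive_group H\<^esub> y \<in> J" by (simp add: additive_group_def J_add)
  qed
qed

lemma normal_J: "J \<lhd> additive_group H"
  by (rule comm_group.subgroup_imp_normal[OF comm_group_H subgroup_J])

lemma torus_group: "group (torus v H i1)"
  unfolding torus_def by (rule normal.factorgroup_is_group[OF normal_J])

lemma carrier_torus: "carrier (torus v H i1) = \<pi>\<^sub>J ` H"
  by (auto simp: torus_def carrier_FactGroup proj_J_def[abs_def] additive_group_def)

lemma torus_mult: "\<pi>\<^sub>J x \<otimes>\<^bsub>torus v H i1\<^esub> \<pi>\<^sub>J y = \<pi>\<^sub>J (x + y)" if "x \<in> H" "y \<in> H"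
  using normal.rcos_sum[OF normal_J, of x y] that
  by (simp add: torus_def FactGroup_def proj_J_def additive_group_def)

lemma torus_one: "\<one>\<^bsub>torus v H i1\<^esub> = \<pi>\<^sub>J 0"
  by (simp add: torus_def FactGroup_def proj_J_eq)

lemma torus_inv: "inv\<^bsub>torus v H i1\<^esub> \<pi>\<^sub>J x = \<pi>\<^sub>J (- x)" if "x \<in> H"
  using that subspace_neg[OF subspace_H that]
  by (intro group.inv_equality[OF torus_group]) (auto simp: torus_mult torus_one carrier_torus)

lemma torus_rotation_proj_J: "torus_rotation v H i1 (\<pi>\<^sub>J x) = \<pi>\<^sub>J (x + \<alpha>)" if "x \<in> H"
  using that by (simp add: torus_rotation_def torus_mult proj_in)

lemma topspace_torus: "topspace (torus_topology v H i1) = \<pi>\<^sub>J ` H"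
  by (simp add: torus_topology_def topspace_quotient_topology)

lemma continuous_map_proj_J: "continuous_map (top_of_set H) (torus_topology v H i1) \<pi>\<^sub>J"
  unfolding torus_topology_def by (intro quotient_imp_continuous_map quotient_map_quotient_topology)

lemma closedin_torus_iff:
  "closedin (torus_topology v H i1) K \<longleftrightarrow> K \<subseteq> \<pi>\<^sub>J ` H \<and> closed {x \<in> H. \<pi>\<^sub>J x \<in> K}"
proof -
  have "quotient_map (top_of_set H) (torus_topology v H i1) \<pi>\<^sub>J"
    unfolding torus_topology_def by (rule quotient_map_quotient_topology)
  then have "K \<subseteq> \<pi>\<^sub>J ` H \<Longrightarrow>
      closedin (top_of_set H) {x \<in> H. \<pi>\<^sub>J x \<in> K} = closedin (torus_topology v H i1) K"
    unfolding quotient_map_closedin topspace_torus by simp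
  moreover have "closedin (torus_topology v H i1) K \<Longrightarrow> K \<subseteq> \<pi>\<^sub>J ` H"
    by (metis closedin_subset topspace_torus)
  moreover have "closedin (top_of_set H) {x \<in> H. \<pi>\<^sub>J x \<in> K} \<longleftrightarrow> closed {x \<in> H. \<pi>\<^sub>J x \<in> K}"
    using closed_H by (simp add: closedin_closed_eq)
  ultimately show ?thesis by blast
qed

text \<open>
  The distance between two cosets of \<open>J\<close> as subsets of the Euclidean space is the quotient metric of
  the torus. It separates the cosets because \<open>J\<close> is closed.
\<close>

lemma setdist_proj_J: "setdist (\<pi>\<^sub>J x) (\<pi>\<^sub>J y) = infdist (x - y) J"
proof -
  have "{dist p q |p q. p \<in> \<pi>\<^sub>J x \<and> q \<in> \<pi>\<^sub>J y} = {dist (x - y) j |j. j \<in> J}" (is "?A = ?B")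
  proof (intro equalityI subsetI)
    fix r assume "r \<in> ?A"
    then obtain j k where jk: "j \<in> J" "k \<in> J" and "r = dist (j + x) (k + y)"
      unfolding proj_J_eq by blast
    then have "r = dist (x - y) (k - j)" by (simp add: dist_norm algebra_simps)
    then show "r \<in> ?B" using J_diff[OF jk(2,1)] by blast
  next
    fix r assume "r \<in> ?B"
    then obtain j where "j \<in> J" and "r = dist (0 + x) (j + y)"
      by (auto simp: dist_norm algebra_simps)
    then show "r \<in> ?A" unfolding proj_J_eq using J_0 by blast
  qed
  moreover have "\<pi>\<^sub>J x \<noteq> {}" "\<pi>\<^sub>J y \<noteq> {}" "J \<noteq> {}" using J_0 by (auto simp: proj_J_eq)
  ultimately show ?thesis
    by (simp add: setdist_def infdist_def setcompr_eq_image)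
qed

lemma infdist_J_attained: obtains j where "j \<in> J" "infdist u J = norm (u - j)"
  using infdist_attains_inf[OF closed_J, of u] J_0 by (metis dist_norm empty_iff)

lemma infdist_J_le: "j \<in> J \<Longrightarrow> infdist u J \<le> norm (u - j)"
  using infdist_le[of j J u] by (simp add: dist_norm)

lemma Metric_space_torus: "Metric_space (\<pi>\<^sub>J ` H) setdist"
proof
  fix c c' assume "c \<in> \<pi>\<^sub>J ` H" "c' \<in> \<pi>\<^sub>J ` H"
  then obtain x y where "c = \<pi>\<^sub>J x" "c' = \<pi>\<^sub>J y" by blast
  moreover have "x - y \<in> J \<longleftrightarrow> infdist (x - y) J = 0"
    using in_closed_iff_infdist_zero[OF closed_J] J_0 by blast
  ultimately show "setdist c c' = 0 \<longleftrightarrow> c = c'"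
    by (simp only: setdist_proj_J proj_J_eq_iff)
next
  fix c1 c2 c3 assume "c1 \<in> \<pi>\<^sub>J ` H" "c2 \<in> \<pi>\<^sub>J ` H" "c3 \<in> \<pi>\<^sub>J ` H"
  then obtain x y z where xyz: "c1 = \<pi>\<^sub>J x" "c2 = \<pi>\<^sub>J y" "c3 = \<pi>\<^sub>J z" by blast
  obtain j k where j: "j \<in> J" "infdist (x - y) J = norm (x - y - j)"
    and k: "k \<in> J" "infdist (y - z) J = norm (y - z - k)"
    using infdist_J_attained by metis
  have "infdist (x - z) J \<le> norm ((x - y - j) + (y - z - k))"
    using infdist_J_le[OF J_add[OF j(1) k(1)], of "x - z"] by (simp add: algebra_simps)
  also have "\<dots> \<le> norm (x - y - j) + norm (y - z - k)" by (rule norm_triangle_ineq)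
  finally show "setdist c1 c3 \<le> setdist c1 c2 + setdist c2 c3"
    unfolding xyz setdist_proj_J j k .
qed (auto simp: setdist_sym setdist_pos_le)

lemma mball_torus: "Metric_space.mball (\<pi>\<^sub>J ` H) setdist (\<pi>\<^sub>J x) r = \<pi>\<^sub>J ` (H \<inter> ball x r)" if "x \<in> H"
proof -
  interpret Metric_space "\<pi>\<^sub>J ` H" setdist by (rule Metric_space_torus)
  show ?thesis
  proof (intro equalityI subsetI)
    fix c assume "c \<in> mball (\<pi>\<^sub>J x) r"
    then obtain y where y: "y \<in> H" "c = \<pi>\<^sub>J y" "infdist (x - y) J < r"
      by (auto simp: in_mball setdist_proj_J)
    obtain j where j: "j \<in> J" "infdist (x - y) J = norm (x - y - j)" by (rule infdist_J_attained)
    have "\<pi>\<^sub>J (y + j) = c" using j(1) by (simp add: y(2) proj_J_eq_iff)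
    moreover have "y + j \<in> H" using y(1) j(1) J_sub_H by (blast intro: subspace_add[OF subspace_H])
    moreover have "y + j \<in> ball x r" using y(3) j(2) by (simp add: dist_norm algebra_simps)
    ultimately show "c \<in> \<pi>\<^sub>J ` (H \<inter> ball x r)" by blast
  next
    fix c assume "c \<in> \<pi>\<^sub>J ` (H \<inter> ball x r)"
    then obtain y where "y \<in> H" "c = \<pi>\<^sub>J y" "norm (x - y) < r" by (auto simp: dist_norm)
    then show "c \<in> mball (\<pi>\<^sub>J x) r"
      using that infdist_J_le[OF J_0, of "x - y"] by (auto simp: in_mball setdist_proj_J)
  qed
qed

lemma mtopology_torus: "Metric_space.mtopology (\<pi>\<^sub>J ` H) setdist = torus_topology v H i1"
proof -
  interpret Metric_space "\<pi>\<^sub>J ` H" setdist by (rule Metric_space_torus)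
  have "openin mtopology U \<longleftrightarrow> openin (torus_topology v H i1) U" for U
  proof (cases "U \<subseteq> \<pi>\<^sub>J ` H")
    case True
    have "openin mtopology U \<longleftrightarrow> (\<forall>x\<in>H. \<pi>\<^sub>J x \<in> U \<longrightarrow> (\<exists>r>0. mball (\<pi>\<^sub>J x) r \<subseteq> U))"
      unfolding openin_mtopology using True by blast
    also have "\<dots> \<longleftrightarrow> (\<forall>x\<in>H. \<pi>\<^sub>J x \<in> U \<longrightarrow> (\<exists>r>0. \<pi>\<^sub>J ` (H \<inter> ball x r) \<subseteq> U))"
      by (simp add: mball_torus)
    also have "\<dots> \<longleftrightarrow> openin (top_of_set H) {x \<in> H. \<pi>\<^sub>J x \<in> U}"
    proof -
      have "\<pi>\<^sub>J ` (H \<inter> ball x r) \<subseteq> U \<longleftrightarrow> ball x r \<inter> H \<subseteq> {x \<in> H. \<pi>\<^sub>J x \<in> U}" for x r by auto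
      then show ?thesis unfolding openin_contains_ball by auto
    qed
    also have "\<dots> \<longleftrightarrow> openin (torus_topology v H i1) U"
      using True by (simp add: torus_topology_def openin_quotient_topology)
    finally show ?thesis .
  next
    case False
    then have "\<not> openin mtopology U" "\<not> openin (torus_topology v H i1) U"
      using openin_subset[of "torus_topology v H i1" U] by (auto simp: openin_mtopology topspace_torus)
    then show ?thesis by simp
  qed
  then show ?thesis by (simp add: topology_eq)
qed

end

section \<open>The full shift\<close>

lemma funpow_shift: "(shift ^^ n) x i = x (n + i)"
  by (induction n arbitrary: i) (simp_all add: shift_def)

lemma subword_append: "subword x j (m + n) = subword x j m @ subword x (j + m) n"
  using upt_add_eq_append[of j "j + m" n] by (simp add: subword_def add.assoc)

lemma subword_eq_iff: "subword x j n = subword y k n \<longleftrightarrow> (\<forall>i<n. x (j + i) = y (k + i))"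
  by (auto simp: subword_def list_eq_iff_nth_eq)

text \<open>
  The relation "\<open>y\<close> lies in the orbit closure of \<open>x\<close>", in terms of prefixes; \<open>closure_of_orbit\<close>
  identifies it with the topological notion.
\<close>

definition limit_of_shifts :: "(nat \<Rightarrow> 'a) \<Rightarrow> (nat \<Rightarrow> 'a) \<Rightarrow> bool" where
  "limit_of_shifts x y \<longleftrightarrow> (\<forall>N. \<exists>n. \<forall>i<N. x (n + i) = y i)"

lemma limit_of_shiftsI: "(\<And>N. \<exists>n. \<forall>i<N. x (n + i) = y i) \<Longrightarrow> limit_of_shifts x y"
  by (simp add: limit_of_shifts_def)

lemma limit_of_shiftsE:
  assumes "limit_of_shifts x y" obtains n where "\<forall>i<N. x (n + i) = y i"
  using spec[OF assms[unfolded limit_of_shifts_def], of N] by (rule exE)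

lemma limit_of_shifts_sequenceE:
  assumes "limit_of_shifts x y" obtains n where "\<And>k. \<forall>i<k. x (n k + i) = y i"
  using assms unfolding limit_of_shifts_def by metis

lemma limit_of_shifts_refl: "limit_of_shifts x x"
  by (intro limit_of_shiftsI exI[of _ 0]) simp

lemma limit_of_shifts_trans:
  assumes "limit_of_shifts x y" "limit_of_shifts y z" shows "limit_of_shifts x z"
proof (rule limit_of_shiftsI)
  fix N
  obtain n where n: "\<forall>i<N. y (n + i) = z i" using assms(2) by (rule limit_of_shiftsE)
  obtain m where m: "\<forall>i<n + N. x (m + i) = y i" using assms(1) by (rule limit_of_shiftsE)
  have "\<forall>i<N. x ((m + n) + i) = z i" using n m by (simp add: add.assoc)
  then show "\<exists>n. \<forall>i<N. x (n + i) = z i" by (rule exI)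
qed

lemma topspace_full_shift: "topspace full_shift = UNIV"
  by (simp add: full_shift_def)

lemma openin_full_shift_iff:
  "openin full_shift U \<longleftrightarrow> (\<forall>x\<in>U. \<exists>N. \<forall>y. (\<forall>i<N. y i = x i) \<longrightarrow> y \<in> U)"
proof
  assume "openin full_shift U"
  show "\<forall>x\<in>U. \<exists>N. \<forall>y. (\<forall>i<N. y i = x i) \<longrightarrow> y \<in> U"
  proof
    fix x assume "x \<in> U"
    then obtain B where B: "finite {i. B i \<noteq> UNIV}" "x \<in> Pi\<^sub>E UNIV B" "Pi\<^sub>E UNIV B \<subseteq> U"
      using \<open>openin full_shift U\<close> unfolding full_shift_def openin_product_topology_alt by auto
    obtain N where N: "\<forall>i\<in>{i. B i \<noteq> UNIV}. i < N"
      using B(1) finite_nat_set_iff_bounded by blast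
    have "y \<in> U" if "\<forall>i<N. y i = x i" for y
    proof -
      have "y i \<in> B i" for i
        using that N B(2) by (cases "i < N") (auto simp: PiE_iff)
      then show ?thesis using B(3) by (auto simp: PiE_iff)
    qed
    then show "\<exists>N. \<forall>y. (\<forall>i<N. y i = x i) \<longrightarrow> y \<in> U" by blast
  qed
next
  assume r: "\<forall>x\<in>U. \<exists>N. \<forall>y. (\<forall>i<N. y i = x i) \<longrightarrow> y \<in> U"
  show "openin full_shift U"
    unfolding full_shift_def openin_product_topology_alt
  proof
    fix x assume "x \<in> U"
    then obtain N where N: "\<And>y. (\<forall>i<N. y i = x i) \<Longrightarrow> y \<in> U" using r by blast
    define B where "B i = (if i < N then {x i} else UNIV)" for i
    have "{i. B i \<noteq> UNIV} \<subseteq> {..<N}" by (auto simp: B_def split: if_splits)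
    then have "finite {i. B i \<noteq> UNIV}" by (rule finite_subset) simp
    moreover have "x \<in> Pi\<^sub>E UNIV B" by (auto simp: B_def)
    moreover have "Pi\<^sub>E UNIV B \<subseteq> U"
    proof
      fix y assume y: "y \<in> Pi\<^sub>E UNIV B"
      have "y i = x i" if "i < N" for i
        using PiE_mem[OF y, of i] that by (simp add: B_def)
      then show "y \<in> U" using N by blast
    qed
    ultimately show "\<exists>U'. finite {i \<in> UNIV. U' i \<noteq> topspace (discrete_topology UNIV)} \<and>
        (\<forall>i\<in>UNIV. openin (discrete_topology UNIV) (U' i)) \<and> x \<in> Pi\<^sub>E UNIV U' \<and> Pi\<^sub>E UNIV U' \<subseteq> U"
      by (intro exI[of _ B]) simp
  qed
qed

lemma closure_of_orbit: "full_shift closure_of {(shift ^^ n) x |n. True} = {y. limit_of_shifts x y}"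
proof (intro equalityI subsetI)
  fix y assume y: "y \<in> full_shift closure_of {(shift ^^ n) x |n. True}"
  have "\<exists>n. \<forall>i<N. x (n + i) = y i" for N
  proof -
    have "openin full_shift {z. \<forall>i<N. z i = y i}"
      unfolding openin_full_shift_iff by (intro ballI exI[of _ N]) auto
    moreover have "y \<in> {z. \<forall>i<N. z i = y i}" by simp
    ultimately have "\<exists>z. z \<in> {(shift ^^ n) x |n. True} \<and> z \<in> {z. \<forall>i<N. z i = y i}"
      using conjunct2[OF y[unfolded in_closure_of], THEN spec, of "{z. \<forall>i<N. z i = y i}"] by blast
    then obtain n where "\<forall>i<N. x (n + i) = y i" by (auto simp: funpow_shift)
    then show ?thesis by (rule exI)
  qed
  then show "y \<in> {y. limit_of_shifts x y}" by (simp add: limit_of_shifts_def)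
next
  fix y assume "y \<in> {y. limit_of_shifts x y}"
  then have y: "limit_of_shifts x y" by simp
  show "y \<in> full_shift closure_of {(shift ^^ n) x |n. True}"
    unfolding in_closure_of
  proof (intro conjI allI impI)
    fix T assume "y \<in> T \<and> openin full_shift T"
    then obtain N where N: "\<And>z. (\<forall>i<N. z i = y i) \<Longrightarrow> z \<in> T"
      unfolding openin_full_shift_iff by blast
    obtain n where "\<forall>i<N. x (n + i) = y i" using y by (rule limit_of_shiftsE)
    then have "(shift ^^ n) x \<in> T" by (intro N) (simp add: funpow_shift)
    then show "\<exists>z. z \<in> {(shift ^^ n) x |n. True} \<and> z \<in> T" by blast
  qed (simp add: topspace_full_shift)
qed

lemma topspace_orbit_closure: "topspace (orbit_closure w) = {x. limit_of_shifts w x}"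
  unfolding orbit_closure_def topspace_subtopology closure_of_orbit topspace_full_shift by simp

text \<open>
  A point of the orbit closure of \<open>w\<close> has a dense orbit as soon as its orbit accumulates at the single
  point \<open>w\<close>: by transitivity of \<open>limit_of_shifts\<close> it then also accumulates at everything that \<open>w\<close> does.
\<close>

lemma transitive_points_orbit_closure:
  "transitive_points (orbit_closure w) shift = {x. limit_of_shifts w x \<and> limit_of_shifts x w}"
proof -
  have "orbit_closure w closure_of {(shift ^^ n) x |n. True} = {y. limit_of_shifts x y}"
    if x: "limit_of_shifts w x" for x
  proof -
    have sub: "{y. limit_of_shifts x y} \<subseteq> {y. limit_of_shifts w y}"
      using limit_of_shifts_trans[OF x] by blast
    have "{(shift ^^ n) x |n. True} \<subseteq> {y. limit_of_shifts x y}"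
      unfolding closure_of_orbit[symmetric] by (intro closure_of_subset) (simp add: topspace_full_shift)
    then have "{y. limit_of_shifts w y} \<inter> {(shift ^^ n) x |n. True} = {(shift ^^ n) x |n. True}"
      using sub by blast
    then show ?thesis
      unfolding orbit_closure_def closure_of_subtopology closure_of_orbit
      by (simp only: closure_of_orbit Int_absorb1[OF sub])
  qed
  then show ?thesis
    unfolding transitive_points_def topspace_orbit_closure
    using limit_of_shifts_refl limit_of_shifts_trans by blast
qed

lemma shift_limit_of_shifts: "limit_of_shifts w x \<Longrightarrow> limit_of_shifts w (shift x)"
  by (erule limit_of_shifts_trans, intro limit_of_shiftsI exI[of _ 1]) (simp add: shift_def)

lemma continuous_map_shift: "continuous_map full_shift full_shift shift"
  unfolding continuous_map_def topspace_full_shift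
proof (intro conjI allI impI)
  fix U :: "(nat \<Rightarrow> 'a) set" assume U: "openin full_shift U"
  show "openin full_shift {x \<in> UNIV. shift x \<in> U}"
    unfolding openin_full_shift_iff
  proof
    fix x assume "x \<in> {x \<in> UNIV. shift x \<in> U}"
    then obtain N where "\<And>y. (\<forall>i<N. y i = shift x i) \<Longrightarrow> y \<in> U"
      using U unfolding openin_full_shift_iff by blast
    then have "\<forall>y. (\<forall>i<Suc N. y i = x i) \<longrightarrow> y \<in> {x \<in> UNIV. shift x \<in> U}"
      by (simp add: shift_def)
    then show "\<exists>N. \<forall>y. (\<forall>i<N. y i = x i) \<longrightarrow> y \<in> {x \<in> UNIV. shift x \<in> U}" by blast
  qed
qed simp

lemma transitive_system_orbit_closure:
  fixes w :: "nat \<Rightarrow> 'a::finite"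
  shows "transitive_system (orbit_closure w) shift"
proof -
  have "compact_space (full_shift :: (nat \<Rightarrow> 'a) topology)"
    unfolding full_shift_def by (simp add: compact_space_product_topology compact_space_discrete_topology)
  then have "compact_space (orbit_closure w)"
    unfolding orbit_closure_def by (intro compact_space_subtopology closedin_compact_space) auto
  moreover have "metrizable_space (orbit_closure w)"
    unfolding orbit_closure_def full_shift_def
    by (intro metrizable_space_subtopology) (simp add: metrizable_space_product_topology)
  moreover have "continuous_map (orbit_closure w) (orbit_closure w) shift"
  proof -
    have "shift \<in> topspace (orbit_closure w) \<rightarrow> topspace (orbit_closure w)"
      using shift_limit_of_shifts by (auto simp: topspace_orbit_closure)
    then show ?thesis
      using continuous_map_shift continuous_map_from_subtopology
      unfolding orbit_closure_def continuous_map_in_subtopology by (auto simp: topspace_full_shift)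
  qed
  ultimately show ?thesis
    unfolding transitive_system_def dynamical_system_def transitive_points_orbit_closure
    using limit_of_shifts_refl by blast
qed

section \<open>Letter frequencies of balanced sequences\<close>

lemma abelianization_append: "abelianization (u @ u') = abelianization u + abelianization u'"
  by (simp add: abelianization_def vec_eq_iff)

lemma balanced_letter_freq:
  assumes "balanced C w"
  shows "(\<lambda>n. real (count_list (subword w 0 n) a) / real n) \<longlonglongrightarrow> letter_freq w $ a"
    and "\<bar>real (count_list (subword w 0 n) a) - real n * letter_freq w $ a\<bar> \<le> C"
proof -
  have "\<bar>real (count_list (subword w 0 (m + n)) a) - real (count_list (subword w 0 m) a)
      - real (count_list (subword w 0 n) a)\<bar> \<le> C" for m n
    using assms by (simp add: balanced_def subword_append)
  from quasi_additive_limit[where f = "\<lambda>n. real (count_list (subword w 0 n) a)", OF this]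
  show "(\<lambda>n. real (count_list (subword w 0 n) a) / real n) \<longlonglongrightarrow> letter_freq w $ a"
    and "\<bar>real (count_list (subword w 0 n) a) - real n * letter_freq w $ a\<bar> \<le> C"
    by (simp_all add: letter_freq_def)
qed

lemma sum_letter_freq:
  assumes "balanced C w" shows "(\<Sum>a\<in>UNIV. letter_freq w $ a) = 1"
proof -
  have "(\<lambda>n. \<Sum>a\<in>UNIV. real (count_list (subword w 0 n) a) / real n) \<longlonglongrightarrow> (\<Sum>a\<in>UNIV. letter_freq w $ a)"
    by (intro tendsto_sum balanced_letter_freq[OF assms])
  moreover have "(\<Sum>a\<in>UNIV. real (count_list (subword w 0 n) a) / real n) = 1" if "n \<ge> 1" for n
  proof -
    have "(\<Sum>a\<in>UNIV. count_list (subword w 0 n) a) = length (subword w 0 n)"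
      using sum_count_set[of "subword w 0 n" UNIV] by simp
    also have "\<dots> = n" by (simp add: subword_def)
    finally have "(\<Sum>a\<in>UNIV. real (count_list (subword w 0 n) a)) = real n"
      by (metis of_nat_sum)
    then show ?thesis using that by (simp flip: sum_divide_distrib)
  qed
  then have "(\<lambda>n. \<Sum>a\<in>UNIV. real (count_list (subword w 0 n) a) / real n) \<longlonglongrightarrow> 1"
    by (intro tendsto_eventually eventually_sequentiallyI)
  ultimately show ?thesis by (rule LIMSEQ_unique)
qed

section \<open>Prefix sums and the map to the Rauzy set\<close>

locale balanced_recurrent_sequence =
  fixes w :: "nat \<Rightarrow> 'a::finite" and C :: real and H :: "(real ^ 'a) set" and i1 :: 'a
  assumes recurrent_w: "recurrent w" and balanced_w: "balanced C w"
    and H: "subspace H" "dim H = CARD('a) - 1" "letter_freq w \<notin> H"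
begin

sublocale frequency_hyperplane "letter_freq w" H i1
  using H sum_letter_freq[OF balanced_w] by unfold_locales

definition prefix_sum :: "(nat \<Rightarrow> 'a) \<Rightarrow> nat \<Rightarrow> real ^ 'a" where
  "prefix_sum x n = P (abelianization (subword x 0 n))"

abbreviation R :: "(nat \<Rightarrow> 'a) \<Rightarrow> (real ^ 'a) set" where "R \<equiv> Rauzy_set (letter_freq w) H"
abbreviation \<phi> :: "(nat \<Rightarrow> 'a) \<Rightarrow> real ^ 'a" where "\<phi> \<equiv> phi (letter_freq w) H w"

abbreviation transitive :: "(nat \<Rightarrow> 'a) \<Rightarrow> bool" where
  "transitive x \<equiv> limit_of_shifts w x \<and> limit_of_shifts x w"

lemma Rauzy_eq_closure: "R x = closure (range (prefix_sum x))"
  by (simp add: Rauzy_set_def prefix_sum_def full_SetCompr_eq)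

lemma prefix_sum_in_Rauzy: "prefix_sum x n \<in> R x"
  unfolding Rauzy_eq_closure by (simp add: closure_subset[THEN subsetD])

lemma prefix_sum_in_H: "prefix_sum x n \<in> H"
  by (simp add: prefix_sum_def proj_in)

lemma Rauzy_sub_H: "R x \<subseteq> H"
  unfolding Rauzy_eq_closure using prefix_sum_in_H by (intro closure_minimal closed_H) blast

lemma prefix_sum_0: "prefix_sum x 0 = 0"
  by (simp add: prefix_sum_def subword_def abelianization_def linear_0[OF linear_proj] flip: zero_vec_def)

lemma prefix_sum_add:
  assumes "\<forall>i<m. x (n + i) = y i"
  shows "prefix_sum x (n + m) = prefix_sum x n + prefix_sum y m"
proof -
  have "subword x n m = subword y 0 m" using assms by (simp add: subword_eq_iff)
  then show ?thesis
    by (simp add: prefix_sum_def subword_append abelianization_append linear_add[OF linear_proj])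
qed

lemma prefix_sum_1: "prefix_sum x 1 = P (axis (x 0) 1)"
proof -
  have "abelianization (subword x 0 1) = axis (x 0) (1::real)"
    by (simp add: abelianization_def subword_def axis_def vec_eq_iff)
  then show ?thesis by (simp add: prefix_sum_def)
qed

lemma prefix_sum_Suc: "prefix_sum x (Suc n) = prefix_sum x n + P (axis (x n) 1)"
  using prefix_sum_add[of 1 x n "\<lambda>i. x (n + i)"] prefix_sum_1[of "\<lambda>i. x (n + i)"] by simp

lemma prefix_sum_mod_J: "prefix_sum x n - real n *\<^sub>R \<alpha> \<in> J"
proof (induction n)
  case (Suc n)
  have "prefix_sum x (Suc n) - real (Suc n) *\<^sub>R \<alpha>
      = (prefix_sum x n - real n *\<^sub>R \<alpha>) + (P (axis (x n) 1) - \<alpha>)"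
    by (simp add: prefix_sum_Suc algebra_simps)
  then show ?case using J_add[OF Suc.IH proj_axis_diff_in_J] by simp
qed (simp add: prefix_sum_0 J_0)

text \<open>
  The projection kills the frequency vector, so a prefix sum is the projection of the deviation of the
  letter counts from their expected values, which balance bounds by \<open>C\<close> in every coordinate.
\<close>

lemma bounded_prefix_sums: "bounded (range (prefix_sum w))"
proof -
  have "bounded_linear P" using linear_proj by (rule linear_conv_bounded_linear[THEN iffD1])
  then obtain K where K: "\<And>u. norm (P u) \<le> norm u * K" "0 \<le> K"
    using bounded_linear.nonneg_bounded by blast
  have "norm (prefix_sum w n) \<le> (real CARD('a) * C) * K" for n
  proof -
    let ?u = "abelianization (subword w 0 n) - real n *\<^sub>R letter_freq w"
    have "prefix_sum w n = P ?u"
      by (simp add: prefix_sum_def linear_diff[OF linear_proj] linear_scale[OF linear_proj] proj_v)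
    moreover have "norm ?u \<le> real CARD('a) * C"
    proof -
      have "norm ?u \<le> (\<Sum>a\<in>UNIV. \<bar>?u $ a\<bar>)" by (rule norm_le_l1_cart)
      also have "\<dots> \<le> real CARD('a) * C"
        using balanced_letter_freq(2)[OF balanced_w]
        by (intro order_trans[OF sum_bounded_above[where K = C]]) (auto simp: abelianization_def)
      finally show ?thesis .
    qed
    ultimately show ?thesis
      using order_trans[OF K(1) mult_right_mono[OF _ K(2)]] by simp
  qed
  then show ?thesis by (auto simp: bounded_iff)
qed

lemma compact_Rauzy_w: "compact (R w)"
  unfolding Rauzy_eq_closure compact_closure by (rule bounded_prefix_sums)

text \<open>
  Cutting the prefix of length \<open>n k\<close> off \<open>x\<close> translates the remaining prefix sums by
  \<open>- prefix_sum x (n k)\<close>; in the limit, translating \<open>R y\<close> by \<open>t\<close> lands in \<open>R x\<close>.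
\<close>

lemma Rauzy_translate_subset:
  assumes agree: "\<And>k. \<forall>i<k. x (n k + i) = y i" and lim: "(\<lambda>k. prefix_sum x (n k)) \<longlonglongrightarrow> t"
    and "u \<in> R y"
  shows "u + t \<in> R x"
proof -
  have "prefix_sum y m + t \<in> R x" for m
  proof (rule Lim_in_closed_set)
    show "closed (R x)" by (simp add: Rauzy_eq_closure)
    show "(\<lambda>k. prefix_sum y m + prefix_sum x (n k)) \<longlonglongrightarrow> prefix_sum y m + t"
      by (intro tendsto_intros lim)
    have "prefix_sum y m + prefix_sum x (n k) \<in> R x" if "k \<ge> m" for k
    proof -
      have "\<forall>i<m. x (n k + i) = y i" using agree[of k] that by simp
      from prefix_sum_add[OF this] prefix_sum_in_Rauzy[of x "n k + m"] show ?thesis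
        by (simp add: add.commute)
    qed
    then show "eventually (\<lambda>k. prefix_sum y m + prefix_sum x (n k) \<in> R x) sequentially"
      by (rule eventually_sequentiallyI)
  qed simp
  moreover have "closed ((\<lambda>u. u + t) -` R x)"
    by (intro closed_vimage continuous_intros) (simp add: Rauzy_eq_closure)
  ultimately have "R y \<subseteq> (\<lambda>u. u + t) -` R x"
    unfolding Rauzy_eq_closure[of y] by (intro closure_minimal) auto
  then show ?thesis using \<open>u \<in> R y\<close> by blast
qed

lemma convergent_prefix_sums:
  assumes "compact (R x)" and agree: "\<And>k. \<forall>i<k. x (n k + i) = y i"
  obtains r t where "\<And>k. \<forall>i<k. x (n (r k) + i) = y i" "(\<lambda>k. prefix_sum x (n (r k))) \<longlonglongrightarrow> t"
proof -
  obtain t r where r: "strict_mono r" and lim: "((\<lambda>k. prefix_sum x (n k)) \<circ> r) \<longlonglongrightarrow> t"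
    using \<open>compact (R x)\<close> prefix_sum_in_Rauzy unfolding compact_def by meson
  have "\<forall>i<k. x (n (r k) + i) = y i" for k
    using agree[of "r k"] seq_suble[OF r, of k] by simp
  then show ?thesis by (rule that) (use lim in \<open>simp add: comp_def\<close>)
qed

text \<open>
  For a transitive \<open>x\<close> the inclusion \<open>R x + t \<subseteq> R w\<close> has a counterpart \<open>R w + s \<subseteq> R x\<close>, because \<open>w\<close>
  is also a limit of shifts of \<open>x\<close>. Then \<open>R w\<close> is mapped into itself by the translation by \<open>s + t\<close>,
  and boundedness forces \<open>s = - t\<close>, so both inclusions are equalities.
\<close>

lemma Rauzy_translate:
  assumes x: "transitive x"
    and agree: "\<And>k. \<forall>i<k. w (n k + i) = x i" and lim: "(\<lambda>k. prefix_sum w (n k)) \<longlonglongrightarrow> t"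
  shows "t \<in> R w" "R x = (\<lambda>u. u - t) ` R w" "\<phi> x = t"
proof -
  have into: "u + t \<in> R w" if "u \<in> R x" for u
    using agree lim that by (rule Rauzy_translate_subset)
  have "prefix_sum x 0 + t \<in> R w" by (rule into[OF prefix_sum_in_Rauzy])
  then show t: "t \<in> R w" by (simp add: prefix_sum_0)
  have "R x \<subseteq> (\<lambda>u. u - t) ` R w" using into by force
  moreover have "compact ((\<lambda>u. u - t) ` R w)"
    by (intro compact_continuous_image compact_Rauzy_w continuous_intros)
  ultimately have "bounded (R x)" by (meson bounded_subset compact_imp_bounded)
  then have compact_x: "compact (R x)" by (simp add: compact_eq_bounded_closed Rauzy_eq_closure)
  obtain m where m: "\<And>k. \<forall>i<k. x (m k + i) = w i"
    using conjunct2[OF x] by (rule limit_of_shifts_sequenceE) blast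
  obtain r s where "\<And>k. \<forall>i<k. x (m (r k) + i) = w i" "(\<lambda>k. prefix_sum x (m (r k))) \<longlonglongrightarrow> s"
    using compact_x m by (rule convergent_prefix_sums) blast
  then have onto: "u + s \<in> R x" if "u \<in> R w" for u
    using that by (rule Rauzy_translate_subset)
  have "s + t = 0"
  proof (rule bounded_translation_eq_0)
    show "bounded (R w)" by (rule compact_imp_bounded[OF compact_Rauzy_w])
    show "R w \<noteq> {}" using t by blast
    show "u + (s + t) \<in> R w" if "u \<in> R w" for u
      using into[OF onto[OF that]] by (simp add: add.assoc)
  qed
  then have "s = - t" by (rule eq_neg_iff_add_eq_0[THEN iffD2])
  then have "(\<lambda>u. u - t) ` R w \<subseteq> R x" using onto by auto
  with \<open>R x \<subseteq> (\<lambda>u. u - t) ` R w\<close> show eq: "R x = (\<lambda>u. u - t) ` R w" by blast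
  show "\<phi> x = t" unfolding phi_def
  proof (rule the_equality)
    fix t' assume t': "t' \<in> R w \<and> R x = (\<lambda>y. y - t') ` R w"
    have "t - t' = 0"
    proof (rule bounded_translation_eq_0)
      show "bounded (R w)" by (rule compact_imp_bounded[OF compact_Rauzy_w])
      show "R w \<noteq> {}" using t by blast
      show "u + (t - t') \<in> R w" if "u \<in> R w" for u
      proof -
        have "u - t' \<in> R x" using t' that by blast
        then show ?thesis using into[of "u - t'"] by (simp add: algebra_simps)
      qed
    qed
    then show "t' = t" by simp
  qed (use t eq in blast)
qed

text \<open>
  The shifts of \<open>w\<close> that agree with \<open>x\<close> on longer and longer prefixes have prefix sums tending to
  \<open>\<phi> x\<close>: every limit point of these prefix sums equals \<open>\<phi> x\<close>, and they range over a compact set.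
\<close>

lemma prefix_sum_near_phi:
  assumes x: "transitive x" and "e > 0"
  obtains N where "\<And>n. \<forall>i<N. w (n + i) = x i \<Longrightarrow> dist (prefix_sum w n) (\<phi> x) < e"
proof (rule ccontr)
  assume "\<not> thesis"
  then have far: "\<exists>n. (\<forall>i<N. w (n + i) = x i) \<and> e \<le> dist (prefix_sum w n) (\<phi> x)" for N
    using that by (meson not_le)
  obtain n where n: "\<And>k. \<forall>i<k. w (n k + i) = x i" "\<And>k. e \<le> dist (prefix_sum w (n k)) (\<phi> x)"
    using far by metis
  obtain r t where r: "\<And>k. \<forall>i<k. w (n (r k) + i) = x i" "(\<lambda>k. prefix_sum w (n (r k))) \<longlonglongrightarrow> t"
    using compact_Rauzy_w n(1) by (rule convergent_prefix_sums) blast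
  have "\<phi> x = t" by (rule Rauzy_translate(3)[OF x r])
  then show False using metric_LIMSEQ_D[OF r(2) \<open>e > 0\<close>] n(2) by (meson le_refl not_le)
qed

lemma phi_eq_limit:
  assumes "transitive x"
  obtains n where "\<And>k. \<forall>i<k. w (n k + i) = x i" "(\<lambda>k. prefix_sum w (n k)) \<longlonglongrightarrow> \<phi> x"
proof -
  obtain n where n: "\<And>k. \<forall>i<k. w (n k + i) = x i"
    using conjunct1[OF assms] by (rule limit_of_shifts_sequenceE) blast
  obtain r t where r: "\<And>k. \<forall>i<k. w (n (r k) + i) = x i" "(\<lambda>k. prefix_sum w (n (r k))) \<longlonglongrightarrow> t"
    using compact_Rauzy_w n by (rule convergent_prefix_sums) blast
  have "\<phi> x = t" by (rule Rauzy_translate(3)[OF assms r])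
  with r show ?thesis by (intro that[of "\<lambda>k. n (r k)"]) auto
qed

lemma phi_in_Rauzy: "\<phi> x \<in> R w" if "transitive x"
  using phi_eq_limit[OF that] Rauzy_translate(1)[OF that] by metis

lemma phi_w: "\<phi> w = 0"
  using Rauzy_translate(3)[of w "\<lambda>_. 0" 0] limit_of_shifts_refl[of w] by (simp add: prefix_sum_0)

lemma phi_continuous:
  assumes x: "transitive x" and "e > 0"
  obtains N where "\<And>y. transitive y \<Longrightarrow> \<forall>i<N. y i = x i \<Longrightarrow> dist (\<phi> y) (\<phi> x) < e"
proof -
  obtain N where N: "\<And>n. \<forall>i<N. w (n + i) = x i \<Longrightarrow> dist (prefix_sum w n) (\<phi> x) < e / 2"
    using prefix_sum_near_phi[OF x, of "e / 2"] \<open>e > 0\<close> by auto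
  have "dist (\<phi> y) (\<phi> x) < e" if y: "transitive y" "\<forall>i<N. y i = x i" for y
  proof -
    obtain N' where N': "\<And>n. \<forall>i<N'. w (n + i) = y i \<Longrightarrow> dist (prefix_sum w n) (\<phi> y) < e / 2"
      using prefix_sum_near_phi[OF y(1), of "e / 2"] \<open>e > 0\<close> by auto
    obtain n where n: "\<forall>i<max N N'. w (n + i) = y i"
      using limit_of_shiftsE[OF conjunct1[OF y(1)]] by metis
    have "dist (prefix_sum w n) (\<phi> x) < e / 2" using n y(2) by (intro N) simp
    moreover have "dist (prefix_sum w n) (\<phi> y) < e / 2" using n by (intro N') simp
    ultimately show ?thesis by (rule dist_triangle_half_r[rotated])
  qed
  then show ?thesis by (rule that)
qed

lemma continuous_map_phi:
  "continuous_map (subtopology (orbit_closure w) {x. transitive x}) euclidean \<phi>"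
proof -
  have "openin (subtopology full_shift {x. transitive x}) {x \<in> {x. transitive x}. \<phi> x \<in> U}"
    if "open U" for U
  proof -
    \<comment> \<open>the union of all cylinders around transitive points whose transitive points are mapped into \<open>U\<close>\<close>
    let ?V = "{y. \<exists>x N. transitive x \<and> (\<forall>z. transitive z \<longrightarrow> (\<forall>i<N. z i = x i) \<longrightarrow> \<phi> z \<in> U) \<and>
        (\<forall>i<N. y i = x i)}"
    have "openin full_shift ?V"
      unfolding openin_full_shift_iff
    proof
      fix y assume "y \<in> ?V"
      then obtain x N where xN: "transitive x" "\<forall>z. transitive z \<longrightarrow> (\<forall>i<N. z i = x i) \<longrightarrow> \<phi> z \<in> U"
        "\<forall>i<N. y i = x i" by blast
      have "z \<in> ?V" if "\<forall>i<N. z i = y i" for z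
      proof -
        have "\<forall>i<N. z i = x i" using xN(3) that by simp
        then show ?thesis using xN(1,2) by blast
      qed
      then show "\<exists>N. \<forall>z. (\<forall>i<N. z i = y i) \<longrightarrow> z \<in> ?V" by blast
    qed
    moreover have "{x \<in> {x. transitive x}. \<phi> x \<in> U} = ?V \<inter> {x. transitive x}"
    proof (intro equalityI subsetI)
      fix x assume "x \<in> {x \<in> {x. transitive x}. \<phi> x \<in> U}"
      then have x: "transitive x" "\<phi> x \<in> U" by auto
      then obtain e where e: "e > 0" "\<And>u. dist u (\<phi> x) < e \<Longrightarrow> u \<in> U"
        using \<open>open U\<close> unfolding open_dist by blast
      obtain N where "\<And>y. transitive y \<Longrightarrow> \<forall>i<N. y i = x i \<Longrightarrow> dist (\<phi> y) (\<phi> x) < e"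
        using phi_continuous[OF x(1) e(1)] by blast
      then have "\<forall>z. transitive z \<longrightarrow> (\<forall>i<N. z i = x i) \<longrightarrow> \<phi> z \<in> U" using e(2) by blast
      then show "x \<in> ?V \<inter> {x. transitive x}" using x(1) by blast
    next
      fix x assume "x \<in> ?V \<inter> {x. transitive x}"
      then show "x \<in> {x \<in> {x. transitive x}. \<phi> x \<in> U}" by blast
    qed
    ultimately show ?thesis unfolding openin_subtopology by blast
  qed
  moreover have "subtopology (orbit_closure w) {x. transitive x} = subtopology full_shift {x. transitive x}"
  proof -
    have "{x. limit_of_shifts w x} \<inter> {x. transitive x} = {x. transitive x}" by blast
    then show ?thesis
      unfolding orbit_closure_def closure_of_orbit subtopology_subtopology by simp
  qed
  ultimately show ?thesis
    by (simp add: continuous_map_def topspace_full_shift)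
qed

text \<open>
  Recurrence enters here: it provides returns of \<open>w\<close> to its own prefixes at positive times, so that
  deleting the first letter of a transitive point keeps the orbit dense.
\<close>

lemma limit_of_shifts_shift_w: "limit_of_shifts (shift w) w"
proof (rule limit_of_shiftsI)
  fix N
  have "infinite {k. subword w k N = subword w 0 N}"
    using recurrent_w by (simp add: recurrent_def)
  then have "\<not> {k. subword w k N = subword w 0 N} \<subseteq> {0}" by (metis finite.emptyI finite.insertI finite_subset)
  then obtain k where "k \<noteq> 0" "subword w k N = subword w 0 N" by blast
  then obtain m where "subword w (Suc m) N = subword w 0 N" by (cases k) auto
  then have "\<forall>i<N. shift w (m + i) = w i" by (simp add: subword_eq_iff shift_def)
  then show "\<exists>n. \<forall>i<N. shift w (n + i) = w i" by (rule exI)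
qed

lemma transitive_shift: "transitive (shift x)" if x: "transitive x"
proof
  show "limit_of_shifts w (shift x)" using x by (blast intro: shift_limit_of_shifts)
  have "limit_of_shifts (shift x) (shift w)"
  proof (rule limit_of_shiftsI)
    fix N
    obtain n where "\<forall>i<Suc N. x (n + i) = w i" using limit_of_shiftsE[OF conjunct2[OF x]] by metis
    then have "\<forall>i<N. shift x (n + i) = shift w i" by (simp add: shift_def flip: add_Suc_right)
    then show "\<exists>n. \<forall>i<N. shift x (n + i) = shift w i" by (rule exI)
  qed
  then show "limit_of_shifts (shift x) w" by (rule limit_of_shifts_trans[OF _ limit_of_shifts_shift_w])
qed

text \<open>
  Moving to \<open>shift x\<close> moves the approximating times by one. Agreement of \<open>w\<close> with \<open>x\<close> on a nonempty
  prefix makes the additional letter equal to \<open>x 0\<close>; the times \<open>n (Suc k)\<close> guarantee this for all \<open>k\<close>.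
\<close>

lemma phi_shift: "\<phi> (shift x) = \<phi> x + P (axis (x 0) 1)" if x: "transitive x"
proof -
  obtain n where n: "\<And>k. \<forall>i<k. w (n k + i) = x i" "(\<lambda>k. prefix_sum w (n k)) \<longlonglongrightarrow> \<phi> x"
    using phi_eq_limit[OF x] by metis
  have "prefix_sum w (Suc (n (Suc k))) = prefix_sum w (n (Suc k)) + P (axis (x 0) 1)" for k
    using n(1)[of "Suc k"] by (auto simp: prefix_sum_Suc dest: spec[of _ 0])
  moreover have "(\<lambda>k. prefix_sum w (n (Suc k)) + P (axis (x 0) 1)) \<longlonglongrightarrow> \<phi> x + P (axis (x 0) 1)"
    by (intro tendsto_intros LIMSEQ_Suc n(2))
  ultimately have lim: "(\<lambda>k. prefix_sum w (Suc (n (Suc k)))) \<longlonglongrightarrow> \<phi> x + P (axis (x 0) 1)" by simp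
  have "\<forall>i<k. w (Suc (n (Suc k)) + i) = shift x i" for k
    using n(1)[of "Suc k"] by (simp add: shift_def flip: add_Suc_right)
  then show ?thesis
    by (rule Rauzy_translate(3)[OF transitive_shift[OF x] _ lim])
qed

end

section \<open>The rotation on the image of the Rauzy set\<close>

context balanced_recurrent_sequence
begin

abbreviation torus_space :: "(real ^ 'a) set topology" where
  "torus_space \<equiv> torus_topology (letter_freq w) H i1"
abbreviation T :: "(real ^ 'a) set \<Rightarrow> (real ^ 'a) set" where
  "T \<equiv> torus_rotation (letter_freq w) H i1"
abbreviation G :: "(real ^ 'a) set set" where "G \<equiv> \<pi>\<^sub>J ` R w"

text \<open>The preimage in \<open>H\<close> of the forward orbit of the neutral element under the rotation.\<close>

definition lifted_orbit :: "(real ^ 'a) set" where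
  "lifted_orbit = {real n *\<^sub>R \<alpha> + j |n j. j \<in> J}"

lemma lifted_orbitI: "j \<in> J \<Longrightarrow> real n *\<^sub>R \<alpha> + j \<in> lifted_orbit"
  unfolding lifted_orbit_def by blast

lemma lifted_orbitE:
  assumes "x \<in> lifted_orbit" obtains n j where "j \<in> J" "x = real n *\<^sub>R \<alpha> + j"
  using assms unfolding lifted_orbit_def by blast

lemma J_sub_closure: "J \<subseteq> closure lifted_orbit"
  using lifted_orbitI[of _ 0] closure_subset by force

lemma closure_lifted_orbit_sub_H: "closure lifted_orbit \<subseteq> H"
proof (rule closure_minimal[OF _ closed_H])
  show "lifted_orbit \<subseteq> H"
    using J_sub_H proj_in subspace_add[OF subspace_H] subspace_scale[OF subspace_H]
    by (blast elim: lifted_orbitE)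
qed

lemma lifted_orbit_add:
  assumes "x \<in> lifted_orbit" "y \<in> lifted_orbit" shows "x + y \<in> lifted_orbit"
proof -
  obtain n j where j: "j \<in> J" "x = real n *\<^sub>R \<alpha> + j" using assms(1) by (rule lifted_orbitE)
  obtain m k where k: "k \<in> J" "y = real m *\<^sub>R \<alpha> + k" using assms(2) by (rule lifted_orbitE)
  have "x + y = real (n + m) *\<^sub>R \<alpha> + (j + k)" by (simp add: j(2) k(2) algebra_simps)
  then show ?thesis using lifted_orbitI[OF J_add[OF j(1) k(1)], of "n + m"] by simp
qed

lemma closure_lifted_orbit_add:
  "x \<in> closure lifted_orbit \<Longrightarrow> y \<in> closure lifted_orbit \<Longrightarrow> x + y \<in> closure lifted_orbit"
  by (rule closure_add_closed[OF lifted_orbit_add])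

text \<open>
  \<open>w\<close> returns to its prefixes at positive times, and the prefix sums at the return times tend to
  \<open>\<phi> w = 0\<close>. Removing one step of the rotation leaves points of the orbit that tend to \<open>- \<alpha>\<close>.
\<close>

lemma minus_rotation_in_closure: "- \<alpha> \<in> closure lifted_orbit"
  unfolding closure_approachable
proof (intro allI impI)
  fix e :: real assume "e > 0"
  obtain N where N: "\<And>n. \<forall>i<N. w (n + i) = w i \<Longrightarrow> dist (prefix_sum w n) (\<phi> w) < e"
    using prefix_sum_near_phi[OF _ \<open>e > 0\<close>, of w] limit_of_shifts_refl[of w] by metis
  obtain n where "\<forall>i<N. shift w (n + i) = w i"
    using limit_of_shifts_shift_w by (rule limit_of_shiftsE)
  then have "norm (prefix_sum w (Suc n)) < e" using N[of "Suc n"] by (simp add: phi_w shift_def)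
  moreover have "prefix_sum w (Suc n) - \<alpha>
      = real n *\<^sub>R \<alpha> + (prefix_sum w (Suc n) - real (Suc n) *\<^sub>R \<alpha>)"
    by (simp add: algebra_simps)
  then have "prefix_sum w (Suc n) - \<alpha> \<in> lifted_orbit"
    using lifted_orbitI[OF prefix_sum_mod_J] by metis
  ultimately show "\<exists>y\<in>lifted_orbit. dist y (- \<alpha>) < e"
    by (intro bexI[of _ "prefix_sum w (Suc n) - \<alpha>"]) (simp_all add: dist_norm)
qed

text \<open>As the closure is additively closed, \<open>- \<alpha>\<close> provides the inverses of all the multiples of \<open>\<alpha>\<close>.\<close>

lemma closure_lifted_orbit_minus:
  assumes "x \<in> closure lifted_orbit" shows "- x \<in> closure lifted_orbit"
proof (rule closure_minus_closed[OF _ assms])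
  fix y assume "y \<in> lifted_orbit"
  then obtain n j where y: "j \<in> J" "y = real n *\<^sub>R \<alpha> + j" by (rule lifted_orbitE)
  have "real n *\<^sub>R (- \<alpha>) \<in> closure lifted_orbit"
  proof (induction n)
    case 0
    show ?case using J_0 J_sub_closure by auto
  next
    case (Suc n)
    then show ?case
      using closure_lifted_orbit_add[OF minus_rotation_in_closure Suc.IH] by (simp add: algebra_simps)
  qed
  moreover have "- j \<in> closure lifted_orbit" using J_minus[OF y(1)] J_sub_closure by blast
  ultimately have "real n *\<^sub>R (- \<alpha>) + - j \<in> closure lifted_orbit" by (rule closure_lifted_orbit_add)
  then show "- y \<in> closure lifted_orbit" by (simp add: y(2))
qed

text \<open>
  The prefix sum of length \<open>n\<close> is congruent to \<open>n *\<^sub>R \<alpha>\<close> modulo \<open>J\<close>, whatever its letters are.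
  Hence \<open>R w\<close> lies in the closure of the lifted orbit; conversely \<open>R w + J\<close> contains the orbit and is
  closed because \<open>R w\<close> is compact.
\<close>

lemma proj_J_in_G_iff: "x \<in> H \<and> \<pi>\<^sub>J x \<in> G \<longleftrightarrow> x \<in> closure lifted_orbit"
proof
  assume "x \<in> H \<and> \<pi>\<^sub>J x \<in> G"
  then obtain r where r: "r \<in> R w" "x - r \<in> J" by (auto simp: proj_J_eq_iff)
  have "prefix_sum w n \<in> lifted_orbit" for n
    using lifted_orbitI[OF prefix_sum_mod_J[of w n], of n] by simp
  then have "R w \<subseteq> closure lifted_orbit"
    unfolding Rauzy_eq_closure by (intro closure_mono) blast
  then show "x \<in> closure lifted_orbit"
    using closure_lifted_orbit_add[of "x - r" r] r J_sub_closure by auto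
next
  assume x: "x \<in> closure lifted_orbit"
  have "closed (\<Union>r\<in>R w. \<Union>j\<in>J. {r + j})"
    by (rule compact_closed_sums[OF compact_Rauzy_w closed_J])
  moreover have "lifted_orbit \<subseteq> (\<Union>r\<in>R w. \<Union>j\<in>J. {r + j})"
  proof
    fix y assume "y \<in> lifted_orbit"
    then obtain n j where y: "j \<in> J" "y = real n *\<^sub>R \<alpha> + j" by (rule lifted_orbitE)
    have "y = prefix_sum w n + (j - (prefix_sum w n - real n *\<^sub>R \<alpha>))" by (simp add: y(2))
    then show "y \<in> (\<Union>r\<in>R w. \<Union>j\<in>J. {r + j})"
      using prefix_sum_in_Rauzy J_diff[OF y(1) prefix_sum_mod_J] by blast
  qed
  ultimately have "x \<in> (\<Union>r\<in>R w. \<Union>j\<in>J. {r + j})" using closure_minimal x by blast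
  then obtain r j where "r \<in> R w" "j \<in> J" "x = r + j" by blast
  then have "\<pi>\<^sub>J x = \<pi>\<^sub>J r" by (simp add: proj_J_eq_iff)
  then show "x \<in> H \<and> \<pi>\<^sub>J x \<in> G" using \<open>r \<in> R w\<close> x closure_lifted_orbit_sub_H by auto
qed

lemma G_sub: "G \<subseteq> \<pi>\<^sub>J ` H"
  using Rauzy_sub_H by blast

lemma G_eq: "G = \<pi>\<^sub>J ` closure lifted_orbit"
proof (intro equalityI subsetI)
  fix c assume c: "c \<in> G"
  then obtain x where "x \<in> H" "c = \<pi>\<^sub>J x" using G_sub by auto
  then show "c \<in> \<pi>\<^sub>J ` closure lifted_orbit" using c proj_J_in_G_iff[of x] by simp
next
  fix c assume "c \<in> \<pi>\<^sub>J ` closure lifted_orbit"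
  then obtain x where "x \<in> closure lifted_orbit" "c = \<pi>\<^sub>J x" by (rule imageE)
  then show "c \<in> G" using proj_J_in_G_iff[of x] by simp
qed

lemma closedin_G: "closedin torus_space G"
proof -
  have "{x \<in> H. \<pi>\<^sub>J x \<in> G} = closure lifted_orbit" by (simp only: proj_J_in_G_iff Collect_mem_eq)
  then show ?thesis using G_sub by (simp add: closedin_torus_iff)
qed

lemma subgroup_G: "subgroup G (torus (letter_freq w) H i1)"
proof (rule group.subgroupI[OF torus_group])
  show "G \<subseteq> carrier (torus (letter_freq w) H i1)" using G_sub by (simp add: carrier_torus)
  show "G \<noteq> {}" using prefix_sum_in_Rauzy by blast
next
  fix c assume "c \<in> G"
  then obtain x where x: "c = \<pi>\<^sub>J x" "x \<in> closure lifted_orbit" unfolding G_eq by blast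
  moreover have "x \<in> H" using x(2) closure_lifted_orbit_sub_H by blast
  ultimately show "inv\<^bsub>torus (letter_freq w) H i1\<^esub> c \<in> G"
    unfolding G_eq by (simp add: torus_inv imageI closure_lifted_orbit_minus)
next
  fix c c' assume "c \<in> G" "c' \<in> G"
  then obtain x y where xy: "c = \<pi>\<^sub>J x" "x \<in> closure lifted_orbit" "c' = \<pi>\<^sub>J y" "y \<in> closure lifted_orbit"
    unfolding G_eq by blast
  moreover have "x \<in> H" "y \<in> H" using xy(2,4) closure_lifted_orbit_sub_H by auto
  ultimately show "c \<otimes>\<^bsub>torus (letter_freq w) H i1\<^esub> c' \<in> G"
    unfolding G_eq by (simp add: torus_mult imageI closure_lifted_orbit_add)
qed

lemma rotation_in_closure: "\<alpha> \<in> closure lifted_orbit"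
  using lifted_orbitI[OF J_0, of 1] closure_subset by force

lemma G_closed_subgroup_generated:
  "G = closed_subgroup_generated (torus (letter_freq w) H i1) torus_space {\<pi>\<^sub>J \<alpha>}"
proof
  have "\<pi>\<^sub>J \<alpha> \<in> G" unfolding G_eq using rotation_in_closure by blast
  then show "closed_subgroup_generated (torus (letter_freq w) H i1) torus_space {\<pi>\<^sub>J \<alpha>} \<subseteq> G"
    unfolding closed_subgroup_generated_def using subgroup_G closedin_G by blast
next
  have "G \<subseteq> K" if K: "subgroup K (torus (letter_freq w) H i1)" "closedin torus_space K" "\<pi>\<^sub>J \<alpha> \<in> K" for K
  proof -
    have multiples: "\<pi>\<^sub>J (real n *\<^sub>R \<alpha>) \<in> K" for n
    proof (induction n)
      case 0
      show ?case using subgroup.one_closed[OF K(1)] by (simp add: torus_one)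
    next
      case (Suc n)
      have "\<pi>\<^sub>J (real n *\<^sub>R \<alpha>) \<otimes>\<^bsub>torus (letter_freq w) H i1\<^esub> \<pi>\<^sub>J \<alpha> \<in> K"
        using Suc.IH K(3) by (rule subgroup.m_closed[OF K(1)])
      then show ?case
        by (simp add: torus_mult proj_in subspace_scale[OF subspace_H] algebra_simps)
    qed
    have "lifted_orbit \<subseteq> {x \<in> H. \<pi>\<^sub>J x \<in> K}"
    proof
      fix x assume x: "x \<in> lifted_orbit"
      then obtain n j where "j \<in> J" "x = real n *\<^sub>R \<alpha> + j" by (rule lifted_orbitE)
      then have "\<pi>\<^sub>J x = \<pi>\<^sub>J (real n *\<^sub>R \<alpha>)" by (simp add: proj_J_eq_iff)
      moreover have "x \<in> H" using x closure_lifted_orbit_sub_H closure_subset by blast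
      ultimately show "x \<in> {x \<in> H. \<pi>\<^sub>J x \<in> K}" using multiples by simp
    qed
    moreover have "closed {x \<in> H. \<pi>\<^sub>J x \<in> K}" using K(2) by (simp add: closedin_torus_iff)
    ultimately have "closure lifted_orbit \<subseteq> {x \<in> H. \<pi>\<^sub>J x \<in> K}" by (rule closure_minimal)
    then show ?thesis unfolding G_eq by blast
  qed
  then show "G \<subseteq> closed_subgroup_generated (torus (letter_freq w) H i1) torus_space {\<pi>\<^sub>J \<alpha>}"
    unfolding closed_subgroup_generated_def by blast
qed

abbreviation G_space :: "(real ^ 'a) set topology" where "G_space \<equiv> subtopology torus_space G"

lemma topspace_G: "topspace G_space = G"
  using G_sub by (simp add: topspace_torus Int_absorb1)

lemma T_in_G:
  assumes "c \<in> G" shows "T c \<in> G"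
proof -
  obtain x where x: "c = \<pi>\<^sub>J x" "x \<in> closure lifted_orbit" using assms unfolding G_eq by blast
  then have "T c = \<pi>\<^sub>J (x + \<alpha>)" using closure_lifted_orbit_sub_H by (auto simp: torus_rotation_proj_J)
  then show ?thesis
    unfolding G_eq using closure_lifted_orbit_add[OF x(2) rotation_in_closure] by blast
qed

lemma T_funpow: "(T ^^ n) (\<pi>\<^sub>J x) = \<pi>\<^sub>J (x + real n *\<^sub>R \<alpha>)" if "x \<in> H"
proof (induction n)
  case (Suc n)
  have "x + real n *\<^sub>R \<alpha> \<in> H"
    using that by (intro subspace_add[OF subspace_H] subspace_scale[OF subspace_H] proj_in)
  then show ?case by (simp add: Suc.IH torus_rotation_proj_J algebra_simps)
qed simp

lemma T_isometry: "setdist ((T ^^ n) c) ((T ^^ n) c') = setdist c c'"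
  if "c \<in> \<pi>\<^sub>J ` H" "c' \<in> \<pi>\<^sub>J ` H"
  using that by (auto simp: T_funpow setdist_proj_J)

lemma G_metric: "Metric_space G setdist" "Metric_space.mtopology G setdist = G_space"
proof -
  interpret Submetric "\<pi>\<^sub>J ` H" setdist G
    using Metric_space_torus G_sub by (simp add: Submetric_def Submetric_axioms_def)
  show "Metric_space G setdist" by (rule sub.Metric_space_axioms)
  show "Metric_space.mtopology G setdist = G_space"
    using mtopology_submetric by (simp add: mtopology_torus)
qed

lemma continuous_map_T: "continuous_map G_space G_space T"
proof -
  have "continuous_map (top_of_set H) (top_of_set H) (\<lambda>x. x + \<alpha>)"
    by (auto intro!: continuous_intros subspace_add[OF subspace_H] proj_in)
  then have "continuous_map (top_of_set H) torus_space (\<pi>\<^sub>J \<circ> (\<lambda>x. x + \<alpha>))"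
    by (rule continuous_map_compose[OF _ continuous_map_proj_J])
  then have "continuous_map (top_of_set H) torus_space (T \<circ> \<pi>\<^sub>J)"
    by (rule continuous_map_eq) (simp add: torus_rotation_proj_J)
  moreover have "quotient_map (top_of_set H) torus_space \<pi>\<^sub>J"
    unfolding torus_topology_def by (rule quotient_map_quotient_topology)
  ultimately have "continuous_map torus_space torus_space T"
    by (simp add: continuous_compose_quotient_map_eq)
  then show ?thesis
    using T_in_G by (auto simp: continuous_map_in_subtopology continuous_map_from_subtopology)
qed

lemma dynamical_system_G: "dynamical_system G_space T"
proof -
  have "compactin torus_space G"
    by (rule image_compactin[OF _ continuous_map_proj_J])
      (simp add: compactin_subtopology compact_Rauzy_w Rauzy_sub_H)
  then have "compact_space G_space" by (rule compact_space_subtopology)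
  moreover have "metrizable_space G_space"
    unfolding metrizable_space_def using G_metric by metis
  ultimately show ?thesis by (simp add: dynamical_system_def continuous_map_T)
qed

lemma equicontinuous_G: "equicontinuous_system G_space T"
  unfolding equicontinuous_system_def topspace_G
proof (intro conjI dynamical_system_G exI[of _ setdist] G_metric allI impI)
  fix e :: real assume "e > 0"
  then show "\<exists>r>0. \<forall>x\<in>G. \<forall>y\<in>G. setdist x y < r \<longrightarrow> (\<forall>n. setdist ((T ^^ n) x) ((T ^^ n) y) < e)"
    using T_isometry G_sub by (intro exI[of _ e]) (auto simp: subset_iff)
qed

text \<open>
  A point of \<open>G\<close> is \<open>\<pi>\<^sub>J x\<close> for an \<open>x\<close> in the closure of the lifted orbit. Its orbit lifts to the translate
  of the lifted orbit by \<open>x\<close>, and the closure of this translate is again the closure of the lifted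
  orbit, as the latter is a group containing \<open>x\<close>.
\<close>

lemma transitive_points_G: "transitive_points G_space T = G"
proof -
  have "G \<subseteq> G_space closure_of {(T ^^ n) c |n. True}" (is "G \<subseteq> ?K") if "c \<in> G" for c
  proof
    fix c' assume "c' \<in> G"
    obtain x y where x: "c = \<pi>\<^sub>J x" "x \<in> closure lifted_orbit"
      and y: "c' = \<pi>\<^sub>J y" "y \<in> closure lifted_orbit"
      using \<open>c \<in> G\<close> \<open>c' \<in> G\<close> unfolding G_eq by blast
    have "x \<in> H" using x(2) closure_lifted_orbit_sub_H by blast
    have orbit: "{(T ^^ n) c |n. True} \<subseteq> ?K"
    proof (rule closure_of_subset)
      have "(T ^^ n) c \<in> G" for n using \<open>c \<in> G\<close> T_in_G by (induction n) auto
      then show "{(T ^^ n) c |n. True} \<subseteq> topspace G_space" unfolding topspace_G by blast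
    qed
    have "closedin torus_space ?K" by (rule closedin_trans_full[OF closedin_closure_of closedin_G])
    then have "closed {z \<in> H. \<pi>\<^sub>J z \<in> ?K}" unfolding closedin_torus_iff by blast
    then have "closed ((\<lambda>z. x + z) -` {z \<in> H. \<pi>\<^sub>J z \<in> ?K})"
      by (intro closed_vimage continuous_intros)
    moreover have "lifted_orbit \<subseteq> (\<lambda>z. x + z) -` {z \<in> H. \<pi>\<^sub>J z \<in> ?K}"
    proof
      fix z assume z: "z \<in> lifted_orbit"
      then obtain n j where j: "j \<in> J" "z = real n *\<^sub>R \<alpha> + j" by (rule lifted_orbitE)
      then have "\<pi>\<^sub>J (x + z) = (T ^^ n) c" by (simp add: x(1) T_funpow \<open>x \<in> H\<close> proj_J_eq_iff)
      then have "\<pi>\<^sub>J (x + z) \<in> ?K" using orbit by auto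
      moreover have "z \<in> H" using z closure_subset closure_lifted_orbit_sub_H by blast
      ultimately show "z \<in> (\<lambda>z. x + z) -` {z \<in> H. \<pi>\<^sub>J z \<in> ?K}"
        using \<open>x \<in> H\<close> by (simp add: subspace_add[OF subspace_H])
    qed
    ultimately have "closure lifted_orbit \<subseteq> (\<lambda>z. x + z) -` {z \<in> H. \<pi>\<^sub>J z \<in> ?K}"
      by (rule closure_minimal[rotated])
    moreover have "y - x \<in> closure lifted_orbit"
      using closure_lifted_orbit_add[OF y(2) closure_lifted_orbit_minus[OF x(2)]] by simp
    ultimately have "y - x \<in> (\<lambda>z. x + z) -` {z \<in> H. \<pi>\<^sub>J z \<in> ?K}" by (rule subsetD)
    then show "c' \<in> ?K" by (simp add: y(1))
  qed
  moreover have "G_space closure_of S \<subseteq> G" for S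
    using closure_of_subset_topspace[of G_space S] unfolding topspace_G .
  ultimately show ?thesis unfolding transitive_points_def topspace_G by blast
qed

text \<open>
  The image of a transitive point only has to lie in \<open>G\<close>, since all points of \<open>G\<close> are transitive. The
  step \<open>P (axis (x 0) 1)\<close> of \<open>\<phi>\<close> depends on the letter \<open>x 0\<close>, but its class modulo \<open>J\<close> does not.
\<close>

lemma generic_factor_map_G:
  "generic_factor_map (orbit_closure w) shift G_space T (\<pi>\<^sub>J \<circ> \<phi>)"
  unfolding generic_factor_map_def transitive_points_G transitive_points_orbit_closure
proof (intro conjI ballI)
  show "transitive_system (orbit_closure w) shift" by (rule transitive_system_orbit_closure)
  have "G \<noteq> {}" using prefix_sum_in_Rauzy by blast
  then show "transitive_system G_space T"
    using dynamical_system_G by (simp add: transitive_system_def transitive_points_G)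
  have "continuous_map (subtopology (orbit_closure w) {x. transitive x}) (top_of_set H) \<phi>"
    using continuous_map_phi phi_in_Rauzy Rauzy_sub_H
    by (fastforce simp: continuous_map_in_subtopology)
  then have "continuous_map (subtopology (orbit_closure w) {x. transitive x}) torus_space (\<pi>\<^sub>J \<circ> \<phi>)"
    by (rule continuous_map_compose[OF _ continuous_map_proj_J])
  then show "continuous_map (subtopology (orbit_closure w) {x. transitive x}) (subtopology G_space G) (\<pi>\<^sub>J \<circ> \<phi>)"
    unfolding subtopology_subtopology Int_absorb using phi_in_Rauzy
    by (simp add: continuous_map_in_subtopology image_subset_iff)
next
  fix x assume "x \<in> {x. transitive x}"
  then have x: "transitive x" by simp
  then show "shift x \<in> {x. transitive x}" using transitive_shift by simp
  have "\<pi>\<^sub>J (\<phi> (shift x)) = \<pi>\<^sub>J (\<phi> x + \<alpha>)"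
    using proj_axis_diff_in_J by (simp add: phi_shift[OF x] proj_J_eq_iff)
  moreover have "\<phi> x \<in> H" using phi_in_Rauzy[OF x] Rauzy_sub_H by blast
  ultimately show "(\<pi>\<^sub>J \<circ> \<phi>) (shift x) = T ((\<pi>\<^sub>J \<circ> \<phi>) x)" by (simp add: torus_rotation_proj_J)
qed

end

theorem corollary3p10:
  fixes w :: "nat \<Rightarrow> 'a::finite" and C :: real and H :: "(real ^ 'a) set" and i1 :: 'a
  defines "v \<equiv> letter_freq w"
  defines "X \<equiv> orbit_closure w"
  defines "T \<equiv> torus_rotation v H i1"
  defines "G \<equiv> proj_J v H i1 ` Rauzy_set v H w"
  defines "GX \<equiv> subtopology (torus_topology v H i1) G"
  assumes "recurrent w" and "balanced C w"
    and "subspace H" and "dim H = CARD('a) - 1" and "v \<notin> H"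
  shows "generic_factor_map X shift GX T (proj_J v H i1 \<circ> phi v H w) \<and>
    equicontinuous_system GX T \<and>
    G = closed_subgroup_generated (torus v H i1) (torus_topology v H i1)
          {proj_J v H i1 (proj_along v H (axis i1 1))}"
proof -
  interpret balanced_recurrent_sequence w C H i1
    using assms(6-) unfolding v_def by unfold_locales
  show ?thesis
    unfolding v_def X_def T_def G_def GX_def
    using generic_factor_map_G equicontinuous_G G_closed_subgroup_generated by blast
qed

end
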